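(* For each quasi-periodic labelling $\rho$, the group $G_\rho$ is not inner amenable.
   Context: A group $G$ is inner amenable if the conjugation action of $G$ on itself admits an atomless invariant mean: a finitely additive probability measure $\mu$ defined on all subsets of $G$ with $\mu(g^{-1}Ag)=\mu(A)$ for all $g\in G$, $A\subseteq G$, and $\mu(\{g\})=0$ for all $g\in G$. Maps act on the right: $x\cdot f$ is the image of $x$ under $f$, and $fg$ means first $f$, then $g$. $\mathrm{Supp}(f)=\{x : x\cdot f\neq x\}$. Thompson's group $F$ is the group of piecewise linear orientation-preserving homeomorphisms of $[0,1]$ that are differentiable except at finitely many dyadic rationals and whose derivatives, where they exist, are integer powers of $2$; $F'=[F,F]$. For dyadic rationals $0\le r<s\le 1$, $F_{[r,s]}$ is the subgroup of elements of $F$ with support in $[r,s]$. Let $\iota_0$ be the map $t\mapsto 1-t$ of $[0,1]$. Fix $c_0\in F$ with $\mathrm{Supp}(c_0)=(0,\tfrac14)$, $x\cdot c_0>x$ for all $x\in(0,\tfrac14)$, and $t\cdot c_0=2t$ for $t\in(0,\tfrac1{16})$. Put $c_1=\iota_0 c_0\iota_0$ and $\nu_1=c_0c_1$. Fix homeomorphisms $\nu_2,\nu_3$ of $[0,1]$ with supports in $(\tfrac1{16},\tfrac{15}{16})$ that generate $F_{[1/16,15/16]}$. Let $H=\langle F',\nu_1\rangle=\langle \nu_1,\nu_2,\nu_3\rangle$. A labelling is a map $\rho:\tfrac12\mathbf{Z}\to\{a,b,a^{-1},b^{-1}\}$ with $\rho(k)\in\{a,a^{-1}\}$ for $k\in\mathbf{Z}$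 and $\rho(k)\in\{b,b^{-1}\}$ for $k\in\tfrac12\mathbf{Z}\setminus\mathbf{Z}$. A block is a set $X=\{k,k+\tfrac12,\ldots,k+\tfrac12 n\}$ with $k\in\tfrac12\mathbf{Z}$, $n\in\mathbf{N}$; its word is $W_\rho(X)=\rho(k)\rho(k+\tfrac12)\cdots\rho(k+\tfrac12n)$, and $W_\rho^{-1}(X)$ is the formal inverse word (reverse the order and invert each letter). The labelling $\rho$ is quasi-periodic if (1) for each block $X$ there is $n\in\mathbf{N}$ such that for every block $Y$ of size at least $n$, $W_\rho(X)$ is a subword (string of consecutive letters) of $W_\rho(Y)$; and (2) for each block $X$ there is a block $Y$ with $W_\rho(Y)=W_\rho^{-1}(X)$. For a labelling $\rho$ and $i\in\{1,2,3\}$ define homeomorphisms $\zeta_i,\chi_i$ of $\mathbf{R}$ by: for $n\in\mathbf{Z}$, $t\in[0,1]$, $(n+t)\cdot\zeta_i=n+t\cdot\nu_i$ if $\rho(n+\tfrac12)=b$ and $(n+t)\cdot\zeta_i=n+t\cdot(\iota_0\nu_i\iota_0)$ if $\rho(n+\tfrac12)=b^{-1}$; $(n-\tfrac12+t)\cdot\chi_i=n-\tfrac12+t\cdot\nu_i$ if $\rho(n)=a$ and $(n-\tfrac12+t)\cdot\chi_i=n-\tfrac12+t\cdot(\iota_0\nu_i\iota_0)$ if $\rho(n)=a^{-1}$. Then $G_\rho=\langle\zeta_1,\zeta_2,\zeta_3,\chi_1,\chi_2,\chi_3\rangle<\mathrm{Homeo}^+(\mathbf{R})$. *)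

theory Defs
  imports
    "HOL-Analysis.Analysis"
    "HOL-Algebra.Generated_Groups"
    "HOL-Library.Sublist"
begin

section \<open>Inner amenability\<close>

definition inner_amenable :: "('a, 'b) monoid_scheme \<Rightarrow> bool" where
  "inner_amenable G \<longleftrightarrow>
     (\<exists>\<mu> :: 'a set \<Rightarrow> real.
        (\<forall>A \<subseteq> carrier G. 0 \<le> \<mu> A) \<and>
        \<mu> (carrier G) = 1 \<and>
        additive (Pow (carrier G)) \<mu> \<and>
        (\<forall>g \<in> carrier G. \<forall>A \<subseteq> carrier G.
           \<mu> ((\<lambda>x. inv\<^bsub>G\<^esub> g \<otimes>\<^bsub>G\<^esub> x \<otimes>\<^bsub>G\<^esub> g) ` A) = \<mu> A) \<and>
        (\<forall>g \<in> carrier G. \<mu> {g} = 0))"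

section \<open>Homeomorphism groups, acting on the right\<close>

text \<open>Homeomorphisms of \<open>S\<close> are represented by extensional functions, as in
  HOL-Algebra's \<open>BijGroup\<close>, but since maps act on the right the product
  \<open>f \<otimes> g\<close> means first \<open>f\<close>, then \<open>g\<close>.\<close>

definition homeo_group :: "real set \<Rightarrow> (real \<Rightarrow> real) monoid" where
  "homeo_group S =
     \<lparr>carrier = {f \<in> extensional S. \<exists>g. homeomorphism S S f g},
      mult = (\<lambda>f g. compose S g f),
      one = (\<lambda>x\<in>S. x)\<rparr>"

definition homeo_plus :: "real set \<Rightarrow> (real \<Rightarrow> real) monoid" where
  "homeo_plus S =
     (homeo_group S)\<lparr>carrier := {f \<in> carrier (homeo_group S). strict_mono_on S f}\<rparr>"

section \<open>Thompson's group F\<close>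

abbreviation unit_int :: "real set" where "unit_int \<equiv> {0..1}"

definition supp :: "(real \<Rightarrow> real) \<Rightarrow> real set" where
  "supp f = {x \<in> unit_int. f x \<noteq> x}"

definition dyadic_rationals :: "real set" where
  "dyadic_rationals = {x. \<exists>(m::int) (n::nat). x = of_int m / 2 ^ n}"

definition piecewise_linear :: "(real \<Rightarrow> real) \<Rightarrow> bool" where
  "piecewise_linear f \<longleftrightarrow>
     (\<exists>D. finite D \<and>
        (\<forall>u v. 0 \<le> u \<and> u < v \<and> v \<le> 1 \<and> {u<..<v} \<inter> D = {} \<longrightarrow>
           (\<exists>m c. \<forall>x \<in> {u..v}. f x = m * x + c)))"

text \<open>Derivatives are taken within \<open>[0,1]\<close>, hence one-sided at the end points.\<close>

definition thompson_F :: "(real \<Rightarrow> real) set" where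
  "thompson_F =
     {f \<in> carrier (homeo_plus unit_int).
        piecewise_linear f \<and>
        (\<exists>D. finite D \<and> D \<subseteq> dyadic_rationals \<and>
           (\<forall>x \<in> unit_int - D. f differentiable (at x within unit_int))) \<and>
        (\<forall>x \<in> unit_int. \<forall>d. (f has_real_derivative d) (at x within unit_int) \<longrightarrow>
           (\<exists>k::int. d = 2 powi k))}"

definition thompson_F_on :: "real \<Rightarrow> real \<Rightarrow> (real \<Rightarrow> real) set" where
  "thompson_F_on r s = {f \<in> thompson_F. supp f \<subseteq> {r..s}}"

definition iota0 :: "real \<Rightarrow> real" where
  "iota0 = (\<lambda>t\<in>unit_int. 1 - t)"

definition reflect :: "(real \<Rightarrow> real) \<Rightarrow> real \<Rightarrow> real" where
  "reflect f = iota0 \<otimes>\<^bsub>homeo_group unit_int\<^esub> f \<otimes>\<^bsub>homeo_group unit_int\<^esub> iota0"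

definition nu1 :: "(real \<Rightarrow> real) \<Rightarrow> real \<Rightarrow> real" where
  "nu1 c0 = c0 \<otimes>\<^bsub>homeo_group unit_int\<^esub> reflect c0"

section \<open>Quasi-periodic labellings\<close>

datatype letter = Let_a | Let_b | Let_a_inv | Let_b_inv

fun inv_letter :: "letter \<Rightarrow> letter" where
  "inv_letter Let_a = Let_a_inv"
| "inv_letter Let_b = Let_b_inv"
| "inv_letter Let_a_inv = Let_a"
| "inv_letter Let_b_inv = Let_b"

definition inv_word :: "letter list \<Rightarrow> letter list" where
  "inv_word w = map inv_letter (rev w)"

definition half_ints :: "real set" where
  "half_ints = {x. \<exists>k::int. x = of_int k / 2}"

text \<open>A map on half-integers is represented by a function on the reals; its values
  outside \<open>half_ints\<close> are never used.\<close>

definition labelling :: "(real \<Rightarrow> letter) \<Rightarrow> bool" where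
  "labelling \<rho> \<longleftrightarrow>
     (\<forall>k \<in> \<int>. \<rho> k \<in> {Let_a, Let_a_inv}) \<and>
     (\<forall>k \<in> half_ints - \<int>. \<rho> k \<in> {Let_b, Let_b_inv})"

definition is_block :: "real set \<Rightarrow> bool" where
  "is_block X \<longleftrightarrow> (\<exists>k \<in> half_ints. \<exists>n::nat. X = (\<lambda>i. k + real i / 2) ` {0..n})"

definition block_word :: "(real \<Rightarrow> letter) \<Rightarrow> real set \<Rightarrow> letter list" where
  "block_word \<rho> X = map \<rho> (sorted_list_of_set X)"

definition quasi_periodic :: "(real \<Rightarrow> letter) \<Rightarrow> bool" where
  "quasi_periodic \<rho> \<longleftrightarrow>
     (\<forall>X. is_block X \<longrightarrow>
        (\<exists>n::nat. \<forall>Y. is_block Y \<and> n \<le> card Y \<longrightarrow>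
           sublist (block_word \<rho> X) (block_word \<rho> Y))) \<and>
     (\<forall>X. is_block X \<longrightarrow>
        (\<exists>Y. is_block Y \<and> block_word \<rho> Y = inv_word (block_word \<rho> X)))"

section \<open>The groups \<open>G\<^sub>\<rho>\<close>\<close>

text \<open>Here \<open>x = n + t\<close> with \<open>n = \<lfloor>x\<rfloor>\<close> for \<open>zeta\<close>, and
  \<open>x = n - 1/2 + t\<close> with \<open>n = \<lfloor>x + 1/2\<rfloor>\<close> for \<open>chi\<close>. This picks
  \<open>t\<close> in \<open>[0,1)\<close>; the value \<open>t = 1\<close> gives the same maps, see the lemmas
  \<open>zeta_eq\<close> and \<open>chi_eq\<close> below.\<close>

definition zeta :: "(real \<Rightarrow> letter) \<Rightarrow> (real \<Rightarrow> real) \<Rightarrow> real \<Rightarrow> real" where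
  "zeta \<rho> \<nu> x =
     (let n = real_of_int \<lfloor>x\<rfloor>; t = x - n
      in n + (if \<rho> (n + 1/2) = Let_b then \<nu> t else reflect \<nu> t))"

definition chi :: "(real \<Rightarrow> letter) \<Rightarrow> (real \<Rightarrow> real) \<Rightarrow> real \<Rightarrow> real" where
  "chi \<rho> \<nu> x =
     (let n = real_of_int \<lfloor>x + 1/2\<rfloor>; t = x - (n - 1/2)
      in n - 1/2 + (if \<rho> n = Let_a then \<nu> t else reflect \<nu> t))"

lemma reflect_apply:
  assumes "\<nu> ` unit_int \<subseteq> unit_int" "t \<in> unit_int"
  shows "reflect \<nu> t = 1 - \<nu> (1 - t)"
proof -
  have "\<nu> (1 - t) \<in> unit_int" by (rule subsetD[OF assms(1)], rule imageI) (use assms(2) in auto)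
  then show ?thesis
    using assms(2) by (simp add: reflect_def homeo_group_def iota0_def compose_def)
qed

lemma zeta_eq:
  fixes n :: int
  assumes "\<nu> ` unit_int \<subseteq> unit_int" "\<nu> 0 = 0" "\<nu> 1 = 1" "t \<in> unit_int"
  shows "zeta \<rho> \<nu> (n + t) =
           n + (if \<rho> (n + 1/2) = Let_b then \<nu> t else reflect \<nu> t)"
proof (cases "t = 1")
  case True
  then show ?thesis using assms by (simp add: zeta_def reflect_apply)
next
  case False
  then have "\<lfloor>n + t\<rfloor> = n" using assms(4) by (simp add: floor_eq_iff)
  then show ?thesis by (simp add: zeta_def)
qed

lemma chi_eq:
  fixes n :: int
  assumes "\<nu> ` unit_int \<subseteq> unit_int" "\<nu> 0 = 0" "\<nu> 1 = 1" "t \<in> unit_int"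
  shows "chi \<rho> \<nu> (n - 1/2 + t) =
           n - 1/2 + (if \<rho> n = Let_a then \<nu> t else reflect \<nu> t)"
proof (cases "t = 1")
  case True
  have "\<lfloor>n - 1/2 + (1::real) + 1/2\<rfloor> = n + 1" by linarith
  then show ?thesis using assms True by (simp add: chi_def reflect_apply)
next
  case False
  then have "\<lfloor>n - 1/2 + t + 1/2\<rfloor> = n" using assms(4) by (simp add: floor_eq_iff)
  then show ?thesis by (simp add: chi_def)
qed

definition G_rho ::
  "(real \<Rightarrow> real) \<Rightarrow> (real \<Rightarrow> real) \<Rightarrow> (real \<Rightarrow> real) \<Rightarrow> (real \<Rightarrow> letter) \<Rightarrow> (real \<Rightarrow> real) monoid"
where
  "G_rho \<nu>1 \<nu>2 \<nu>3 \<rho> =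
     (homeo_plus UNIV)\<lparr>carrier := generate (homeo_plus UNIV)
        {zeta \<rho> \<nu>1, zeta \<rho> \<nu>2, zeta \<rho> \<nu>3, chi \<rho> \<nu>1, chi \<rho> \<nu>2, chi \<rho> \<nu>3}\<rparr>"

end

theory Submission
  imports Defs
begin

text \<open>
  For \<open>g \<noteq> 1\<close> in \<open>G\<^sub>\<rho>\<close> let \<open>D\<^sub>g\<close> be the frontier of the set of fixed points of \<open>g\<close>. It is
  nonempty, because \<open>g\<close> has a fixed point: near the centre of a block with the inverse word, \<open>g\<close>
  acts by the mirror image of its action near the centre of the original block, hence moves points
  in the opposite direction. It is uniformly locally finite, because \<open>g\<close> is piecewise affine with a
  bounded number of break points per unit length. As all elements of \<open>G\<^sub>\<rho>\<close> have bounded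
  displacement, the density along an ultrafilter of a set relative to \<open>D\<^sub>g\<close> in the windows
  \<open>[-n,n]\<close> is a finitely additive probability measure on the line that depends equivariantly on
  \<open>g\<close>. So an invariant atomless mean on \<open>G\<^sub>\<rho>\<close> would yield an invariant mean on the line. There is
  none: some element generated by the \<open>\<zeta>\<^sub>i\<close> moves \<open>\<int> + [1/4,3/4]\<close> to infinitely many disjoint sets,
  and likewise with the \<open>\<chi>\<^sub>i\<close> and the translate of this set by \<open>1/2\<close>; together the two sets cover
  the line.
\<close>

section \<open>Finitely additive measures\<close>

text \<open>Two sets of positions are needed because a cellwise map on the cells [n,n+1] fixes every
  integer and one on the half-shifted cells fixes every n + 1/2: neither kind of map displaces the
  whole line, but what one leaves in place is interior to a cell of the other. No limit of densities
  is formed. In each window one asks whether at least half of the frontier lies in a given set, and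
  the ultrafilter settles the answer. All constants come from this. Of two sets covering the line,
  one always holds half. Moving a set by a homeomorphism costs a bounded boundary term, so one half
  drops to 2/5, any value strictly between 1/3 and 1/2 being as good: as it exceeds 1/3, at most two
  of several disjoint images can hold that share. Five conjugates then bound the mean of either
  class by 2/5, and 2/5 + 2/5 < 1.\<close>

lemma sum_additive_le_multiplicity:
  fixes \<mu> :: "'a set \<Rightarrow> real"
  assumes add: "additive (Pow \<Omega>) \<mu>" and nonneg: "\<And>A. A \<subseteq> \<Omega> \<Longrightarrow> 0 \<le> \<mu> A"
    and I: "finite (I :: 'i set)" and sub: "\<And>i. i \<in> I \<Longrightarrow> S i \<subseteq> \<Omega>"
    and mult: "\<And>x. x \<in> \<Omega> \<Longrightarrow> card {i\<in>I. x \<in> S i} \<le> m"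
  shows "(\<Sum>i\<in>I. \<mu> (S i)) \<le> m * \<mu> \<Omega>"
proof -
  have empty: "\<mu> {} = 0"
    using additiveD[OF add, of "{}" "{}"] by simp
  have Union: "\<mu> (\<Union>(A ` J)) = (\<Sum>j\<in>J. \<mu> (A j))"
    if "finite J" "\<And>j. j \<in> J \<Longrightarrow> A j \<subseteq> \<Omega>" "disjoint_family_on A J" for A :: "'i set \<Rightarrow> 'a set" and J
    using that
  proof induction
    case (insert j J)
    have "A j \<inter> \<Union>(A ` J) = {}"
      using insert.hyps insert.prems(2) by (auto simp: disjoint_family_on_def)
    then have "\<mu> (A j \<union> \<Union>(A ` J)) = \<mu> (A j) + \<mu> (\<Union>(A ` J))"
      using add insert.prems(1) by (intro additiveD[OF add]) auto
    then show ?case using insert by (simp add: disjoint_family_on_def)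
  qed (simp add: empty)
  \<comment> \<open>The atoms are the cells of the Venn diagram of the family \<open>S\<close>;
    exactly \<open>card P\<close> of the sets contain \<open>atom P\<close>, so both sides can be
    compared atom by atom.\<close>
  define atom where "atom P = {x\<in>\<Omega>. {i\<in>I. x \<in> S i} = P}" for P
  have split: "\<mu> A = (\<Sum>P\<in>Pow I. \<mu> (A \<inter> atom P))" if "A \<subseteq> \<Omega>" for A
  proof -
    have "A = (\<Union>P\<in>Pow I. A \<inter> atom P)"
      using that by (auto simp: atom_def)
    moreover have "\<mu> (\<Union>P\<in>Pow I. A \<inter> atom P) = (\<Sum>P\<in>Pow I. \<mu> (A \<inter> atom P))"
      using that by (intro Union) (auto simp: I disjoint_family_on_def atom_def)
    ultimately show ?thesis by simp
  qed
  have S_atom: "S i \<inter> atom P = (if i \<in> P then atom P else {})" if "i \<in> I" for i P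
    using sub[OF that] that by (auto simp: atom_def)
  have "(\<Sum>i\<in>I. \<mu> (S i)) = (\<Sum>i\<in>I. \<Sum>P\<in>Pow I. \<mu> (S i \<inter> atom P))"
    by (intro sum.cong refl split sub)
  also have "\<dots> = (\<Sum>P\<in>Pow I. \<Sum>i\<in>I. \<mu> (S i \<inter> atom P))"
    by (rule sum.swap)
  also have "\<dots> \<le> (\<Sum>P\<in>Pow I. m * \<mu> (atom P))"
  proof (rule sum_mono)
    fix P assume P: "P \<in> Pow I"
    have "(\<Sum>i\<in>I. \<mu> (S i \<inter> atom P)) = (\<Sum>i\<in>I. if i \<in> P then \<mu> (atom P) else 0)"
      using P by (intro sum.cong refl) (simp add: S_atom empty)
    also have "\<dots> = card P * \<mu> (atom P)"
      using P I by (simp add: sum.If_cases Int_absorb1)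
    also have "\<dots> \<le> m * \<mu> (atom P)"
    \<comment> \<open>The multiplicity bound needs a point to be applied to; an empty atom
      contributes 0 to both sides.\<close>
    proof (cases "atom P = {}")
      case True
      then show ?thesis by (simp add: empty)
    next
      case False
      then have "card P \<le> m" using mult by (auto simp: atom_def)
      moreover have "0 \<le> \<mu> (atom P)" by (rule nonneg) (auto simp: atom_def)
      ultimately show ?thesis by (intro mult_right_mono) auto
    qed
    finally show "(\<Sum>i\<in>I. \<mu> (S i \<inter> atom P)) \<le> m * \<mu> (atom P)" .
  qed
  also have "\<dots> = m * \<mu> \<Omega>"
    unfolding sum_distrib_left[symmetric] using split[of \<Omega>]
    by (simp add: Int_absorb1 atom_def)
  finally show ?thesis .
qed

text \<open>The predicate \<open>c\<close> is membership in a free ultrafilter on the naturals.\<close>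

lemma free_ultrafilter_choice:
  obtains c :: "nat set \<Rightarrow> bool"
  where "\<And>\<P> N. finite \<P> \<Longrightarrow> \<exists>n\<ge>N. \<forall>P\<in>\<P>. n \<in> P \<longleftrightarrow> c P"
proof -
  \<comment> \<open>Asking for infinite rather than nonempty finite intersections keeps finite sets
    out of a maximal family, which later supplies \<open>n\<close> beyond any given
    \<open>N\<close>.\<close>
  define \<A> :: "nat set set set" where "\<A> = {E. \<forall>F\<subseteq>E. finite F \<longrightarrow> infinite (\<Inter>F)}"
  have "{} \<in> \<A>" by (simp add: \<A>_def)
  have "\<Union>C \<in> \<A>" if chain: "C \<noteq> {}" "subset.chain \<A> C" for C
    unfolding \<A>_def
  proof safe
    fix F assume F: "F \<subseteq> \<Union>C" "finite F" "finite (\<Inter>F)"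
    obtain E where "E \<in> C" "F \<subseteq> E"
      using finite_subset_Union_chain[OF F(2,1) chain] .
    moreover have "E \<in> \<A>" using \<open>E \<in> C\<close> chain by (auto simp: subset.chain_def)
    ultimately show False using F by (auto simp: \<A>_def)
  qed
  then obtain M where M: "M \<in> \<A>" and max: "\<And>E. E \<in> \<A> \<Longrightarrow> M \<subseteq> E \<Longrightarrow> E = M"
    using subset_Zorn_nonempty[of \<A>] \<open>{} \<in> \<A>\<close> by blast
  have fip: "infinite (\<Inter>F)" if "F \<subseteq> M" "finite F" for F
    using M that by (auto simp: \<A>_def)
  have small: "\<exists>F\<subseteq>M. finite F \<and> finite (\<Inter>F \<inter> P)" if "P \<notin> M" for P
  proof -
    have "insert P M \<notin> \<A>" using max[of "insert P M"] that by auto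
    then obtain F where F: "F \<subseteq> insert P M" "finite F" "finite (\<Inter>F)"
      by (auto simp: \<A>_def)
    have "\<Inter>(F - {P}) \<inter> P \<subseteq> \<Inter>F" by auto
    then show ?thesis using F by (intro exI[of _ "F - {P}"]) (auto intro: finite_subset)
  qed
  have ultra: "P \<in> M \<or> - P \<in> M" for P
  proof (rule ccontr)
    assume "\<not> ?thesis"
    then obtain F G where FG: "F \<subseteq> M" "finite F" "finite (\<Inter>F \<inter> P)"
      "G \<subseteq> M" "finite G" "finite (\<Inter>G \<inter> - P)"
      using small[of P] small[of "- P"] by auto
    have "\<Inter>(F \<union> G) \<subseteq> (\<Inter>F \<inter> P) \<union> (\<Inter>G \<inter> - P)" by auto
    then have "finite (\<Inter>(F \<union> G))" using FG by (meson finite_UnI finite_subset)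
    then show False using fip[of "F \<union> G"] FG by auto
  qed
  show ?thesis
  proof (rule that[of "\<lambda>P. P \<in> M"])
    fix \<P> :: "nat set set" and N :: nat
    assume "finite \<P>"
    \<comment> \<open>Each \<open>P\<close> is replaced by whichever of \<open>P\<close> and its
      complement lies in \<open>M\<close>; a point common to these finitely many sets agrees with
      the ultrafilter on all of \<open>\<P>\<close>.\<close>
    define F where "F = (\<lambda>P. if P \<in> M then P else - P) ` \<P>"
    have "F \<subseteq> M" "finite F" using ultra \<open>finite \<P>\<close> by (auto simp: F_def)
    then have "infinite (\<Inter>F)" by (rule fip)
    then obtain n where "n \<ge> N" "n \<in> \<Inter>F"
      by (meson infinite_nat_iff_unbounded_le)
    then show "\<exists>n\<ge>N. \<forall>P\<in>\<P>. n \<in> P \<longleftrightarrow> P \<in> M"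
      by (intro exI[of _ n]) (auto simp: F_def split: if_splits)
  qed
qed

section \<open>Groups of homeomorphisms\<close>

lemma homeo_group_simps [simp]:
  "carrier (homeo_group S) = {f \<in> extensional S. \<exists>g. homeomorphism S S f g}"
  "f \<otimes>\<^bsub>homeo_group S\<^esub> g = compose S g f"
  "\<one>\<^bsub>homeo_group S\<^esub> = (\<lambda>x\<in>S. x)"
  by (simp_all add: homeo_group_def)

lemma homeo_plus_simps [simp]:
  "carrier (homeo_plus S) = {f \<in> carrier (homeo_group S). strict_mono_on S f}"
  "f \<otimes>\<^bsub>homeo_plus S\<^esub> g = compose S g f"
  "\<one>\<^bsub>homeo_plus S\<^esub> = (\<lambda>x\<in>S. x)"
  by (simp_all add: homeo_plus_def homeo_group_def)

lemma homeomorphism_restrict: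
  assumes "homeomorphism S S f g"
  shows "homeomorphism S S (restrict f S) (restrict g S)"
  using assms by (rule homeomorphism_cong) auto

lemma group_homeo_group: "group (homeo_group S)"
proof (rule groupI)
  show "\<one>\<^bsub>homeo_group S\<^esub> \<in> carrier (homeo_group S)"
    using homeomorphism_restrict[OF homeomorphism_ident[of S]] by auto
next
  fix f h assume "f \<in> carrier (homeo_group S)" "h \<in> carrier (homeo_group S)"
  then obtain f' h' where "homeomorphism S S f f'" "homeomorphism S S h h'" by auto
  from homeomorphism_restrict[OF homeomorphism_compose[OF this]]
  show "f \<otimes>\<^bsub>homeo_group S\<^esub> h \<in> carrier (homeo_group S)"
    by (auto simp: compose_def o_def)
next
  fix f g h assume *: "f \<in> carrier (homeo_group S)" "g \<in> carrier (homeo_group S)" "h \<in> carrier (homeo_group S)"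
  then have "f \<in> S \<rightarrow> S" by (auto simp: homeomorphism_def)
  then show "f \<otimes>\<^bsub>homeo_group S\<^esub> g \<otimes>\<^bsub>homeo_group S\<^esub> h = f \<otimes>\<^bsub>homeo_group S\<^esub> (g \<otimes>\<^bsub>homeo_group S\<^esub> h)"
    by (simp add: compose_assoc)
next
  fix f assume "f \<in> carrier (homeo_group S)"
  then obtain g where f: "f \<in> extensional S" and fg: "homeomorphism S S f g" by auto
  from f show "\<one>\<^bsub>homeo_group S\<^esub> \<otimes>\<^bsub>homeo_group S\<^esub> f = f"
    by (auto simp: compose_def restrict_def extensional_def)
  have "restrict g S \<in> carrier (homeo_group S)"
    using homeomorphism_restrict[OF homeomorphism_symD[OF fg]] by auto
  moreover have "restrict g S \<otimes>\<^bsub>homeo_group S\<^esub> f = \<one>\<^bsub>homeo_group S\<^esub>"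
    using fg by (auto simp: homeomorphism_def compose_def restrict_def)
  ultimately show "\<exists>y\<in>carrier (homeo_group S). y \<otimes>\<^bsub>homeo_group S\<^esub> f = \<one>\<^bsub>homeo_group S\<^esub>" by (intro bexI)
qed

lemma continuous_strict_mono_surj:
  fixes f :: "real \<Rightarrow> real"
  assumes "strict_mono f" "surj f"
  shows "continuous_on UNIV f"
  using assms by (intro continuous_onI_mono) (auto simp: strict_mono_less_eq)

text \<open>An increasing surjection of the line has no jumps, and neither has its inverse. This
  turns membership into a purely order-theoretic condition.\<close>

lemma homeo_plus_UNIV_carrier:
  "carrier (homeo_plus UNIV) = {f. strict_mono f \<and> surj f}" (is "?L = ?R")
proof
  show "?L \<subseteq> ?R" by (auto simp: homeomorphism_def)
  show "?R \<subseteq> ?L"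
  proof
    fix f :: "real \<Rightarrow> real" assume "f \<in> ?R"
    then have f: "strict_mono f" "surj f" by auto
    then have bij: "bij f" by (simp add: bij_def strict_mono_imp_inj_on)
    have mono_inv: "inv_into UNIV f x \<le> inv_into UNIV f y" if "x \<le> y" for x y
      using that f by (metis strict_mono_less_eq surj_f_inv_f)
    have "continuous_on UNIV f" using f by (rule continuous_strict_mono_surj)
    moreover have "continuous_on UNIV (inv_into UNIV f)"
      using bij mono_inv by (intro continuous_onI_mono) (auto simp: bij_imp_bij_inv bij_is_surj)
    ultimately have "homeomorphism UNIV UNIV f (inv_into UNIV f)"
      using bij by (auto simp: homeomorphism_def bij_def surj_f_inv_f inj_imp_surj_inv)
    then show "f \<in> ?L" using f by auto
  qed
qed

lemma homeo_plus_UNIV_mult: "f \<otimes>\<^bsub>homeo_plus UNIV\<^esub> g = g \<circ> f"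
  by (simp add: compose_def o_def restrict_def)

lemma homeo_plus_UNIV_one: "\<one>\<^bsub>homeo_plus UNIV\<^esub> = id"
  by (simp add: id_def restrict_def)

lemma strict_mono_inv:
  fixes f :: "'a::linorder \<Rightarrow> 'b::linorder"
  assumes "strict_mono f" "surj f"
  shows "strict_mono (inv_into UNIV f)" "surj (inv_into UNIV f)"
proof -
  show "strict_mono (inv_into UNIV f)"
    using assms by (intro strict_monoI) (metis strict_mono_less surj_f_inv_f)
  show "surj (inv_into UNIV f)" using strict_mono_imp_inj_on[OF assms(1)] by (rule inj_imp_surj_inv)
qed

lemma group_homeo_plus_UNIV: "group (homeo_plus UNIV)"
proof (rule groupI; unfold homeo_plus_UNIV_mult homeo_plus_UNIV_one homeo_plus_UNIV_carrier)
  fix f assume f: "f \<in> {f::real \<Rightarrow> real. strict_mono f \<and> surj f}"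
  then have "inv_into UNIV f \<in> {f. strict_mono f \<and> surj f}" using strict_mono_inv[of f] by blast
  moreover have "f \<circ> inv_into UNIV f = id" using f surj_iff by auto
  ultimately show "\<exists>y\<in>{f. strict_mono f \<and> surj f}. f \<circ> y = id" by (intro bexI)
next
  fix f g assume "f \<in> {f::real \<Rightarrow> real. strict_mono f \<and> surj f}" "g \<in> {f::real \<Rightarrow> real. strict_mono f \<and> surj f}"
  then show "g \<circ> f \<in> {f. strict_mono f \<and> surj f}" using comp_surj[of f g] by (simp add: strict_mono_def)
qed (auto simp: strict_mono_def)

lemma homeo_plus_UNIV_inv:
  assumes "strict_mono f" "surj f"
  shows "inv\<^bsub>homeo_plus UNIV\<^esub> f = inv_into UNIV f"
proof (rule group.inv_equality[OF group_homeo_plus_UNIV])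
  show "inv_into UNIV f \<otimes>\<^bsub>homeo_plus UNIV\<^esub> f = \<one>\<^bsub>homeo_plus UNIV\<^esub>"
    using assms surj_iff unfolding homeo_plus_UNIV_mult homeo_plus_UNIV_one by auto
qed (use assms strict_mono_inv[OF assms] in \<open>simp_all only: homeo_plus_UNIV_carrier mem_Collect_eq simp_thms\<close>)

section \<open>Uniformly locally finite sets and bounded displacement\<close>

text \<open>One bound serves all windows: sets are counted in windows whose ends move off to
  infinity, and the error made near the ends has to stay bounded.\<close>

definition unif_loc_finite :: "real set \<Rightarrow> bool" where
  "unif_loc_finite B \<longleftrightarrow> (\<exists>K. \<forall>x. finite (B \<inter> {x..x+1}) \<and> card (B \<inter> {x..x+1}) \<le> K)"

definition bounded_displacement :: "(real \<Rightarrow> real) \<Rightarrow> bool" where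
  "bounded_displacement h \<longleftrightarrow> (\<exists>C. \<forall>x. \<bar>h x - x\<bar> \<le> C)"

lemma bounded_displacementE:
  assumes "bounded_displacement h"
  obtains C where "C \<ge> 0" "\<And>x. \<bar>h x - x\<bar> \<le> C"
proof -
  obtain C where C: "\<bar>h x - x\<bar> \<le> C" for x
    using assms by (auto simp: bounded_displacement_def)
  then have "C \<ge> 0" using abs_ge_zero order_trans by blast
  then show ?thesis using C by (rule that)
qed

lemma unif_loc_finite_interval:
  assumes "unif_loc_finite B"
  obtains K where "\<And>x. finite (B \<inter> {x..x+L})" "\<And>x. card (B \<inter> {x..x+L}) \<le> K"
proof -
  obtain K where K: "finite (B \<inter> {x..x+1}) \<and> card (B \<inter> {x..x+1}) \<le> K" for x
    using assms by (auto simp: unif_loc_finite_def)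
  have *: "finite (B \<inter> {x..x + real m}) \<and> card (B \<inter> {x..x + real m}) \<le> Suc m * K" for x m
  proof (induction m)
    case 0
    have "B \<inter> {x..x + real 0} \<subseteq> B \<inter> {x..x+1}" by auto
    then show ?case using K[of x] card_mono[of "B \<inter> {x..x+1}" "B \<inter> {x}"]
      by (auto intro: finite_subset)
  next
    case (Suc m)
    have sub: "B \<inter> {x..x + real (Suc m)} \<subseteq> (B \<inter> {x..x + real m}) \<union> (B \<inter> {x + real m..x + real m + 1})"
      by auto
    have fin: "finite ((B \<inter> {x..x + real m}) \<union> (B \<inter> {x + real m..x + real m + 1}))"
      using Suc K by blast
    have "card (B \<inter> {x..x + real (Suc m)}) \<le> card ((B \<inter> {x..x + real m}) \<union> (B \<inter> {x + real m..x + real m + 1}))"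
      by (rule card_mono[OF fin sub])
    also have "\<dots> \<le> card (B \<inter> {x..x + real m}) + card (B \<inter> {x + real m..x + real m + 1})"
      by (rule card_Un_le)
    also have "\<dots> \<le> Suc m * K + K"
      using Suc K by (intro add_mono) auto
    finally show ?case using finite_subset[OF sub fin] by simp
  qed
  define m where "m = nat \<lceil>L\<rceil>"
  have "L \<le> real m" unfolding m_def by (rule real_nat_ceiling_ge)
  then have sub: "B \<inter> {x..x+L} \<subseteq> B \<inter> {x..x + real m}" for x by auto
  show ?thesis
  proof (rule that[of "Suc m * K"])
    fix x
    show "finite (B \<inter> {x..x+L})" using sub[of x] * by (blast intro: finite_subset)
    show "card (B \<inter> {x..x+L}) \<le> Suc m * K"
      using card_mono[OF _ sub[of x]] *[of x m] by linarith
  qed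
qed

lemma unif_loc_finite_Un:
  assumes "unif_loc_finite A" "unif_loc_finite B"
  shows "unif_loc_finite (A \<union> B)"
proof -
  obtain K L where
    "\<And>x. finite (A \<inter> {x..x+1}) \<and> card (A \<inter> {x..x+1}) \<le> K"
    "\<And>x. finite (B \<inter> {x..x+1}) \<and> card (B \<inter> {x..x+1}) \<le> L"
    using assms by (auto simp: unif_loc_finite_def)
  then have "finite ((A \<union> B) \<inter> {x..x+1}) \<and> card ((A \<union> B) \<inter> {x..x+1}) \<le> K + L" for x
    using order_trans[OF card_Un_le[of "A \<inter> {x..x+1}" "B \<inter> {x..x+1}"] add_mono]
    by (auto simp: Int_Un_distrib2)
  then show ?thesis by (auto simp: unif_loc_finite_def)
qed

lemma unif_loc_finite_UN:
  assumes "finite I" "\<And>i. i \<in> I \<Longrightarrow> unif_loc_finite (A i)"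
  shows "unif_loc_finite (\<Union>i\<in>I. A i)"
  using assms
proof (induction)
  case empty
  then show ?case by (auto simp: unif_loc_finite_def)
qed (simp add: unif_loc_finite_Un)

text \<open>Points landing in an interval of length 1 start in an interval of length 2C + 1, where
  \<open>C\<close> bounds the displacement.\<close>

lemma unif_loc_finite_image:
  assumes B: "unif_loc_finite B" and h: "bounded_displacement h"
  shows "unif_loc_finite (h ` B)"
proof -
  obtain C where C: "C \<ge> 0" "\<And>x. \<bar>h x - x\<bar> \<le> C" by (rule bounded_displacementE[OF h]) blast
  obtain K where K: "\<And>x. finite (B \<inter> {x..x+(2*C+1)})" "\<And>x. card (B \<inter> {x..x+(2*C+1)}) \<le> K"
    by (rule unif_loc_finite_interval[OF B, where L = "2*C+1"]) blast
  have sub: "h ` B \<inter> {x..x+1} \<subseteq> h ` (B \<inter> {x-C..(x-C)+(2*C+1)})" for x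
  proof
    fix y assume "y \<in> h ` B \<inter> {x..x+1}"
    then obtain b where "b \<in> B" "y = h b" "x \<le> h b" "h b \<le> x + 1" by auto
    then show "y \<in> h ` (B \<inter> {x-C..(x-C)+(2*C+1)})" using C(2)[of b] by (auto intro!: imageI)
  qed
  have "finite (h ` B \<inter> {x..x+1}) \<and> card (h ` B \<inter> {x..x+1}) \<le> K" for x
    using finite_subset[OF sub[of x]] K[of "x - C"]
      surj_card_le[OF _ sub[of x]] order_trans by blast
  then show ?thesis by (auto simp: unif_loc_finite_def)
qed

lemma bounded_displacement_comp:
  assumes "bounded_displacement f" "bounded_displacement g"
  shows "bounded_displacement (g \<circ> f)"
proof -
  obtain C D where "\<And>x. \<bar>f x - x\<bar> \<le> C" "\<And>x. \<bar>g x - x\<bar> \<le> D"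
    using assms by (auto simp: bounded_displacement_def)
  then have "\<bar>f x - x\<bar> \<le> C" "\<bar>g (f x) - f x\<bar> \<le> D" for x by auto
  then have "\<bar>(g \<circ> f) x - x\<bar> \<le> C + D" for x
    unfolding comp_apply by (smt (verit))
  then show ?thesis by (auto simp: bounded_displacement_def)
qed

lemma bounded_displacement_inv:
  assumes "bounded_displacement f" "surj f"
  shows "bounded_displacement (inv_into UNIV f)"
proof -
  obtain C where "\<And>x. \<bar>f x - x\<bar> \<le> C" using assms by (auto simp: bounded_displacement_def)
  then have "\<bar>inv_into UNIV f x - x\<bar> \<le> C" for x
    using assms(2) by (metis abs_minus_commute surj_f_inv_f)
  then show ?thesis by (auto simp: bounded_displacement_def)
qed

section \<open>Counting in large windows\<close>

lemma finite_subset_window: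
  fixes D :: "real set"
  assumes "finite D"
  shows "\<forall>\<^sub>F n in sequentially. D \<subseteq> {-real n..real n}"
proof -
  obtain C where C: "\<And>x. x \<in> D \<Longrightarrow> \<bar>x\<bar> \<le> C"
    using finite_imp_bounded[OF assms] by (auto simp: bounded_iff)
  have "\<forall>\<^sub>F n in sequentially. C \<le> real n"
    by (rule eventually_sequentiallyI[of "nat \<lceil>C\<rceil>"]) linarith
  then show ?thesis
    by eventually_elim (use C in \<open>force simp: abs_le_iff\<close>)
qed

lemma unif_loc_finite_window:
  assumes "unif_loc_finite D"
  shows "finite (D \<inter> {-real n..real n})"
proof -
  obtain K where "\<And>x. finite (D \<inter> {x..x + 2 * real n})"
    by (rule unif_loc_finite_interval[OF assms]) auto
  from this[of "- real n"] show ?thesis by simp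
qed

text \<open>A homeomorphism of bounded displacement changes counts in large windows only by a bounded
  boundary term, hence nearly preserves relative densities.\<close>

lemma majority_transport:
  assumes h: "strict_mono h" "surj h" and bd: "bounded_displacement h"
    and D: "unif_loc_finite D"
  shows "\<forall>\<^sub>F n in sequentially.
     card (D \<inter> {-real n..real n}) \<le> 2 * card (D \<inter> A \<inter> {-real n..real n}) \<longrightarrow>
     2 * card (h ` D \<inter> {-real n..real n}) \<le> 5 * card (h ` D \<inter> h ` A \<inter> {-real n..real n})"
proof -
  have inj: "inj h" using h(1) by (rule strict_mono_imp_inj_on)
  define V where "V n = {-real n..real n}" for n
  \<comment> \<open>Pulling the window back by \<open>h\<close> replaces counts of images in
    \<open>V n\<close> by counts of the original sets in \<open>V' n\<close>.\<close>
  define V' where "V' n = {x. h x \<in> V n}" for n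
  have card_V': "card (h ` B \<inter> V n) = card (B \<inter> V' n)" for B n
  proof -
    have "h ` B \<inter> V n = h ` (B \<inter> V' n)" by (auto simp: V'_def)
    then show ?thesis using inj by (simp add: card_image inj_on_subset)
  qed
  have image_Int: "h ` D \<inter> h ` A = h ` (D \<inter> A)" using inj by (simp add: image_Int)
  obtain C where C: "C \<ge> 0" "\<And>x. \<bar>h x - x\<bar> \<le> C" by (rule bounded_displacementE[OF bd]) blast
  obtain K where K: "\<And>x. finite (D \<inter> {x..x+2*C})" "\<And>x. card (D \<inter> {x..x+2*C}) \<le> K"
    by (rule unif_loc_finite_interval[OF D, where L = "2*C"]) blast
  \<comment> \<open>A point lying in only one of \<open>V n\<close> and \<open>V' n\<close> is
    within \<open>C\<close> of an end of the window; \<open>R n\<close> collects these points of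
    \<open>D\<close>.\<close>
  define R where "R n = (D \<inter> {-real n-C..(-real n-C)+2*C}) \<union> (D \<inter> {real n-C..(real n-C)+2*C})" for n
  have R: "finite (R n)" "card (R n) \<le> 2 * K" for n
    using K(1)[of "-real n-C"] K(1)[of "real n-C"] K(2)[of "-real n-C"] K(2)[of "real n-C"]
      card_Un_le[of "D \<inter> {-real n-C..(-real n-C)+2*C}" "D \<inter> {real n-C..(real n-C)+2*C}"]
    unfolding R_def by (blast, linarith)
  have VV': "D \<inter> V' n \<subseteq> (D \<inter> V n) \<union> R n" "D \<inter> A \<inter> V n \<subseteq> (D \<inter> A \<inter> V' n) \<union> R n" for n
  proof -
    show "D \<inter> V' n \<subseteq> (D \<inter> V n) \<union> R n"
    proof
      fix x assume "x \<in> D \<inter> V' n"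
      then show "x \<in> (D \<inter> V n) \<union> R n"
        using C(2)[of x] unfolding V_def V'_def R_def by auto
    qed
    show "D \<inter> A \<inter> V n \<subseteq> (D \<inter> A \<inter> V' n) \<union> R n"
    proof
      fix x assume "x \<in> D \<inter> A \<inter> V n"
      then show "x \<in> (D \<inter> A \<inter> V' n) \<union> R n"
        using C(2)[of x] unfolding V_def V'_def R_def by auto
    qed
  qed
  have finV: "finite (D \<inter> V n)" for n
    unfolding V_def using D by (rule unif_loc_finite_window)
  have finV': "finite (D \<inter> V' n)" for n
    using finite_subset[OF VV'(1)] R(1) finV by blast
  \<comment> \<open>Let d and a be the counts of \<open>D\<close> and \<open>D \<inter> A\<close> in
    \<open>V' n\<close>. Changing windows on both sides gives d \<le> 2a + 6K, and this yields 2d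
    \<le> 5a once d \<ge> 30K.\<close>
  have bound: "2 * card (D \<inter> V' n) \<le> 5 * card (D \<inter> A \<inter> V' n)"
    if maj: "card (D \<inter> V n) \<le> 2 * card (D \<inter> A \<inter> V n)" and large: "30 * K \<le> card (D \<inter> V' n)" for n
  proof -
    have "card (D \<inter> V' n) \<le> card (D \<inter> V n) + 2 * K"
      using card_mono[OF _ VV'(1)[of n]] card_Un_le[of "D \<inter> V n" "R n"] R[of n] finV[of n] by force
    moreover have "finite (D \<inter> A \<inter> V' n)" using finV'[of n] by (rule finite_subset[rotated]) auto
    then have "card (D \<inter> A \<inter> V n) \<le> card (D \<inter> A \<inter> V' n) + 2 * K"
      using card_mono[OF _ VV'(2)[of n]] card_Un_le[of "D \<inter> A \<inter> V' n" "R n"] R[of n] by force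
    ultimately show ?thesis using maj large by linarith
  qed
  have "\<forall>\<^sub>F n in sequentially. card (D \<inter> V n) \<le> 2 * card (D \<inter> A \<inter> V n) \<longrightarrow>
     2 * card (D \<inter> V' n) \<le> 5 * card (D \<inter> A \<inter> V' n)"
  \<comment> \<open>A finite \<open>D\<close> is eventually counted in full in both windows, so
    nothing is lost; for an infinite \<open>D\<close> the counts outgrow
    \<open>30 * K\<close>.\<close>
  proof (cases "finite D")
    case True
    have "\<forall>\<^sub>F n in sequentially. D \<subseteq> V n" "\<forall>\<^sub>F n in sequentially. h ` D \<subseteq> V n"
      using finite_subset_window True unfolding V_def by auto
    then show ?thesis
    proof eventually_elim
      case (elim n)
      then have "D \<inter> V n = D" "D \<inter> A \<inter> V n = D \<inter> A" "D \<inter> V' n = D" "D \<inter> A \<inter> V' n = D \<inter> A"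
        by (auto simp: V'_def)
      then show ?case by simp
    qed
  next
    case False
    then obtain F where F: "F \<subseteq> D" "finite F" "card F = 30 * K"
      using infinite_arbitrarily_large by blast
    have "\<forall>\<^sub>F n in sequentially. h ` F \<subseteq> V n"
      using finite_subset_window F(2) unfolding V_def by auto
    then show ?thesis
    proof eventually_elim
      case (elim n)
      then have "F \<subseteq> D \<inter> V' n" using F(1) by (auto simp: V'_def)
      then have "30 * K \<le> card (D \<inter> V' n)" using card_mono[OF finV'] F(3) by metis
      then show ?case using bound by blast
    qed
  qed
  then show ?thesis
    unfolding image_Int card_V'[unfolded V_def] V_def .
qed

section \<open>A criterion for the failure of inner amenability\<close>

text \<open>Fixed points may fill whole intervals and then cannot be counted; the boundary points of
  the fixed set can, for the maps considered here, and they still move along under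
  conjugation.\<close>

definition fix_frontier :: "(real \<Rightarrow> real) \<Rightarrow> real set" where
  "fix_frontier g = frontier {x. g x = x}"

lemma fix_frontier_conj:
  assumes "strict_mono h" "surj h"
  shows "fix_frontier (h \<circ> g \<circ> inv_into UNIV h) = h ` fix_frontier g"
proof -
  have inj: "inj h" using assms(1) by (rule strict_mono_imp_inj_on)
  have "h \<in> carrier (homeo_plus UNIV)" using assms by (simp only: homeo_plus_UNIV_carrier mem_Collect_eq simp_thms)
  then obtain k where k: "homeomorphism UNIV UNIV h k" by auto
  have "homeomorphic_map euclidean euclidean h"
    using k by (auto simp: homeomorphic_map_maps homeomorphic_maps_def homeomorphism_def)
  then have "euclidean frontier_of (h ` {x. g x = x}) = h ` (euclidean frontier_of {x. g x = x})"
    by (rule homeomorphic_map_frontier_of) simp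
  moreover have "{x. (h \<circ> g \<circ> inv_into UNIV h) x = x} = h ` {x. g x = x}"
  proof safe
    fix x assume "(h \<circ> g \<circ> inv_into UNIV h) x = x"
    then have "h (g (inv_into UNIV h x)) = h (inv_into UNIV h x)"
      using assms(2) by (simp add: surj_f_inv_f)
    then have "g (inv_into UNIV h x) = inv_into UNIV h x" by (rule injD[OF inj])
    then show "x \<in> h ` {x. g x = x}" using assms(2) by (intro image_eqI[of _ _ "inv_into UNIV h x"]) (simp_all add: surj_f_inv_f)
  qed (use inj in simp)
  ultimately show ?thesis by (simp add: fix_frontier_def)
qed

text \<open>The line is connected, so only the empty set and the whole line have empty
  frontier.\<close>

lemma fix_frontier_nonempty:
  fixes g :: "real \<Rightarrow> real"
  assumes "g x = x" "g \<noteq> id"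
  shows "fix_frontier g \<noteq> {}"
proof -
  have "{x. g x = x} \<noteq> UNIV" using assms(2) by (auto simp: fun_eq_iff)
  then show ?thesis
    using assms(1) frontier_eq_empty[of "{x. g x = x}"] by (auto simp: fix_frontier_def)
qed

text \<open>\<open>P\<close> is a trap: every later image of \<open>A\<close> lies in
  \<open>P\<close>, hence misses \<open>A\<close>, and injectivity carries this over to any two
  iterates.\<close>

lemma iterates_disjoint:
  fixes f :: "'a \<Rightarrow> 'a"
  assumes "inj f" "f ` (A \<union> P) \<subseteq> P" "A \<inter> P = {}" "i \<noteq> j"
  shows "(f ^^ i) ` A \<inter> (f ^^ j) ` A = {}"
proof -
  have into_P: "(f ^^ Suc m) ` A \<subseteq> P" for m
  proof (induction m)
    case (Suc m)
    have "(f ^^ Suc (Suc m)) ` A = f ` (f ^^ Suc m) ` A" by (simp add: image_comp)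
    then show ?case using Suc assms(2) by blast
  qed (use assms(2) in auto)
  have *: "(f ^^ i) ` A \<inter> (f ^^ j) ` A = {}" if "i < j" for i j
  proof -
    obtain m where m: "j = i + Suc m" using less_imp_Suc_add[of i j] \<open>i < j\<close> by auto
    have "(f ^^ j) ` A = (f ^^ i) ` (f ^^ Suc m) ` A"
      unfolding m funpow_add by (simp only: image_comp)
    moreover have "A \<inter> (f ^^ Suc m) ` A = {}" using into_P assms(3) by blast
    ultimately show ?thesis
      using image_Int[OF inj_fn[OF assms(1)], of i A "(f ^^ Suc m) ` A"] by (metis image_empty)
  qed
  show ?thesis using *[of i j] *[of j i] assms(4) by (cases "i < j") auto
qed

text \<open>One half is the share that at least one of two covering sets reaches in every window.
  Written without division, the inequality makes no exception for windows that contain no frontier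
  point.\<close>

definition major :: "real set \<Rightarrow> (real \<Rightarrow> real) \<Rightarrow> nat set" where
  "major A g = {n. card (fix_frontier g \<inter> {-real n..real n})
                     \<le> 2 * card (fix_frontier g \<inter> A \<inter> {-real n..real n})}"

text \<open>The conjugates of the displayed set by \<open>f\<^sup>0, \<dots>, f\<^sup>4\<close> cover every point at most twice:
  if \<open>g\<close> is in the conjugate by \<open>f\<^sup>k\<close>, then \<open>f\<^sup>k(A)\<close> contains nearly half of the
  frontier of the fixed point set of \<open>g\<close>, and the sets \<open>f\<^sup>k(A)\<close> are disjoint.\<close>

lemma measure_major_le:
  fixes \<mu> :: "(real \<Rightarrow> real) set \<Rightarrow> real"
  assumes H: "\<And>h. h \<in> H \<Longrightarrow> strict_mono h \<and> surj h"
    and bd: "\<And>h. h \<in> H \<Longrightarrow> bounded_displacement h"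
    and ne: "\<And>g. g \<in> H \<Longrightarrow> g \<noteq> id \<Longrightarrow> fix_frontier g \<noteq> {}"
    and ulf: "\<And>g. g \<in> H \<Longrightarrow> unif_loc_finite (fix_frontier g)"
    and conj: "\<And>h g. h \<in> H \<Longrightarrow> g \<in> H \<Longrightarrow> h \<circ> g \<circ> inv_into UNIV h \<in> H"
    and pow: "\<And>k. f ^^ k \<in> H"
    and f: "f ` (A \<union> P) \<subseteq> P" "A \<inter> P = {}"
    and add: "additive (Pow H) \<mu>" and nonneg: "\<And>X. X \<subseteq> H \<Longrightarrow> 0 \<le> \<mu> X" and total: "\<mu> H = 1"
    and inv: "\<And>h X. h \<in> H \<Longrightarrow> X \<subseteq> H \<Longrightarrow> \<mu> ((\<lambda>g. h \<circ> g \<circ> inv_into UNIV h) ` X) = \<mu> X"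
    and c: "\<And>\<P> N. finite \<P> \<Longrightarrow> \<exists>n\<ge>N. \<forall>P\<in>\<P>. n \<in> P \<longleftrightarrow> c P"
  shows "\<mu> {g\<in>H. g \<noteq> id \<and> c (major A g)} \<le> 2/5"
proof -
  define S where "S = {g\<in>H. g \<noteq> id \<and> c (major A g)}"
  define T where "T k = (\<lambda>g. (f ^^ k) \<circ> g \<circ> inv_into UNIV (f ^^ k)) ` S" for k
  have "f \<in> H" using pow[of 1] by simp
  then have inj: "inj f" using H strict_mono_imp_inj_on by blast
  \<comment> \<open>The inequality holds at all large \<open>n\<close> in a set selected by
    \<open>c\<close>. Finitely many such sets share arbitrarily large \<open>n\<close>, so several
    values of \<open>k\<close> can be treated in one window.\<close>
  have transport: "\<exists>M N. c M \<and> x \<in> H \<and> fix_frontier x \<noteq> {} \<and> (\<forall>n\<ge>N. n \<in> M \<longrightarrow>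
      2 * card (fix_frontier x \<inter> {-real n..real n})
       \<le> 5 * card (fix_frontier x \<inter> (f ^^ k) ` A \<inter> {-real n..real n}))"
    if x: "x \<in> T k" for x k
  proof -
    obtain g where g: "g \<in> H" "g \<noteq> id" "c (major A g)"
      and xg: "x = (f ^^ k) \<circ> g \<circ> inv_into UNIV (f ^^ k)"
      using x by (auto simp: T_def S_def)
    have h: "strict_mono (f ^^ k)" "surj (f ^^ k)" using H[OF pow] by auto
    have fr: "fix_frontier x = (f ^^ k) ` fix_frontier g"
      unfolding xg using h by (rule fix_frontier_conj)
    obtain N where N: "\<forall>n\<ge>N. n \<in> major A g \<longrightarrow>
      2 * card (fix_frontier x \<inter> {-real n..real n})
       \<le> 5 * card (fix_frontier x \<inter> (f ^^ k) ` A \<inter> {-real n..real n})"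
      using majority_transport[OF h bd[OF pow] ulf[OF g(1)], of A]
      unfolding fr major_def eventually_sequentially mem_Collect_eq by blast
    moreover have "x \<in> H" unfolding xg by (rule conj[OF pow g(1)])
    moreover have "fix_frontier x \<noteq> {}" using ne[OF g(1,2)] by (simp add: fr)
    ultimately show ?thesis using g(3) by blast
  qed
  have few: "card {k\<in>{..<5}. x \<in> T k} \<le> 2" for x
  proof (rule ccontr)
    assume "\<not> ?thesis"
    then have "3 \<le> card {k\<in>{..<5}. x \<in> T k}" by simp
    then obtain I where "I \<subseteq> {k\<in>{..<5}. x \<in> T k}" "card I = 3"
      by (rule obtain_subset_with_card_n)
    moreover then obtain i j k where "I = {i, j, k}" "i \<noteq> j" "j \<noteq> k" "i \<noteq> k"
      using card_3_iff[of I] by blast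
    ultimately have ijk: "i \<noteq> j" "j \<noteq> k" "i \<noteq> k" "x \<in> T i" "x \<in> T j" "x \<in> T k"
      by auto
    define D where "D n = fix_frontier x \<inter> {-real n..real n}" for n
    define E where "E k n = fix_frontier x \<inter> (f ^^ k) ` A \<inter> {-real n..real n}" for k n
    obtain Mi Ni where i: "c Mi" "\<forall>n\<ge>Ni. n \<in> Mi \<longrightarrow> 2 * card (D n) \<le> 5 * card (E i n)"
      using transport[OF ijk(4)] unfolding D_def E_def by blast
    obtain Mj Nj where j: "c Mj" "\<forall>n\<ge>Nj. n \<in> Mj \<longrightarrow> 2 * card (D n) \<le> 5 * card (E j n)"
      using transport[OF ijk(5)] unfolding D_def E_def by blast
    obtain Mk Nk where k: "c Mk" "\<forall>n\<ge>Nk. n \<in> Mk \<longrightarrow> 2 * card (D n) \<le> 5 * card (E k n)"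
      using transport[OF ijk(6)] unfolding D_def E_def by blast
    have x: "x \<in> H" "fix_frontier x \<noteq> {}" using transport[OF ijk(4)] by auto
    \<comment> \<open>A frontier point inside the window makes \<open>card (D n)\<close> positive;
      otherwise three disjoint shares of 2/5 would be no contradiction.\<close>
    then obtain d where d: "d \<in> fix_frontier x" by auto
    obtain N where N: "\<forall>n\<ge>N. {d} \<subseteq> {-real n..real n}"
      using finite_subset_window[of "{d}"] unfolding eventually_sequentially by auto
    obtain n where n: "n \<ge> Max {Ni, Nj, Nk, N}" "\<forall>P\<in>{Mi, Mj, Mk}. n \<in> P \<longleftrightarrow> c P"
      using c[of "{Mi, Mj, Mk}"] by blast
    have fin: "finite (D n)" unfolding D_def using ulf[OF x(1)] by (rule unif_loc_finite_window)
    have "d \<in> D n" using N n(1) d unfolding D_def by auto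
    then have "card (D n) > 0" using fin card_gt_0_iff by blast
    moreover have "2 * card (D n) \<le> 5 * card (E i n)" "2 * card (D n) \<le> 5 * card (E j n)"
      "2 * card (D n) \<le> 5 * card (E k n)"
      using n i j k by auto
    moreover have "card (E i n) + card (E j n) + card (E k n) \<le> card (D n)"
    proof -
      have sub: "E k n \<subseteq> D n" for k by (auto simp: D_def E_def)
      have finE: "finite (E k n)" for k using sub fin by (rule finite_subset)
      have disj: "E k n \<inter> E l n = {}" if "k \<noteq> l" for k l
        using iterates_disjoint[OF inj f that] by (auto simp: E_def)
      have "(E i n \<union> E j n) \<inter> E k n = {}"
        using disj[OF ijk(2)] disj[OF ijk(3)] by blast
      then have "card (E i n) + card (E j n) + card (E k n) = card (E i n \<union> E j n \<union> E k n)"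
        using disj[OF ijk(1)] finE by (simp add: card_Un_disjoint)
      also have "\<dots> \<le> card (D n)" using sub fin by (intro card_mono) auto
      finally show ?thesis .
    qed
    ultimately show False by linarith
  qed
  have "S \<subseteq> H" by (auto simp: S_def)
  then have T_sub: "T k \<subseteq> H" for k using conj[OF pow] by (auto simp: T_def)
  \<comment> \<open>Five equal measures add up to at most 2. Five is the least number of conjugates
    for which the resulting bound is below 1/2.\<close>
  have "(\<Sum>k<5. \<mu> (T k)) \<le> real 2 * \<mu> H"
    by (rule sum_additive_le_multiplicity[OF add nonneg _ T_sub]) (use few in auto)
  moreover have "\<mu> (T k) = \<mu> S" for k
    unfolding T_def using pow \<open>S \<subseteq> H\<close> by (rule inv)
  ultimately show ?thesis by (simp add: total S_def)
qed

text \<open>\<open>P\<close> and \<open>P'\<close> are traps showing that \<open>A\<close> and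
  \<open>A'\<close> wander. Every \<open>g \<noteq> id\<close> belongs to the class of
  \<open>A\<close> or to that of \<open>A'\<close>, both of measure at most 2/5; the identity, whose
  fixed set has empty frontier, is dealt with by atomlessness.\<close>

theorem not_inner_amenable_criterion:
  assumes H: "subgroup H (homeo_plus UNIV)"
    and bd: "\<And>h. h \<in> H \<Longrightarrow> bounded_displacement h"
    and fixes_point: "\<And>g. g \<in> H \<Longrightarrow> \<exists>x. g x = x"
    and ulf: "\<And>g. g \<in> H \<Longrightarrow> unif_loc_finite (fix_frontier g)"
    and f: "f \<in> H" "f ` (A \<union> P) \<subseteq> P" "A \<inter> P = {}"
    and f': "f' \<in> H" "f' ` (A' \<union> P') \<subseteq> P'" "A' \<inter> P' = {}"
    and cover: "A \<union> A' = UNIV"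
  shows "\<not> inner_amenable ((homeo_plus UNIV)\<lparr>carrier := H\<rparr>)"
proof
  let ?G = "(homeo_plus UNIV)\<lparr>carrier := H\<rparr>"
  have carrier_G: "carrier ?G = H" by simp
  assume "inner_amenable ?G"
  then have ex: "\<exists>\<mu> :: (real \<Rightarrow> real) set \<Rightarrow> real. (\<forall>X\<subseteq>H. 0 \<le> \<mu> X) \<and> \<mu> H = 1 \<and> additive (Pow H) \<mu> \<and>
      (\<forall>g\<in>H. \<forall>X\<subseteq>H. \<mu> ((\<lambda>x. inv\<^bsub>?G\<^esub> g \<otimes>\<^bsub>?G\<^esub> x \<otimes>\<^bsub>?G\<^esub> g) ` X) = \<mu> X) \<and>
      (\<forall>g\<in>H. \<mu> {g} = 0)"
    using carrier_G unfolding inner_amenable_def by (simp only:)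
  then obtain \<mu> :: "(real \<Rightarrow> real) set \<Rightarrow> real"
    where \<mu>: "(\<forall>X\<subseteq>H. 0 \<le> \<mu> X) \<and> \<mu> H = 1 \<and> additive (Pow H) \<mu> \<and>
      (\<forall>g\<in>H. \<forall>X\<subseteq>H. \<mu> ((\<lambda>x. inv\<^bsub>?G\<^esub> g \<otimes>\<^bsub>?G\<^esub> x \<otimes>\<^bsub>?G\<^esub> g) ` X) = \<mu> X) \<and>
      (\<forall>g\<in>H. \<mu> {g} = 0)" ..
  then have total: "\<mu> H = 1" and add: "additive (Pow H) \<mu>" by blast+
  have nonneg: "0 \<le> \<mu> X" if "X \<subseteq> H" for X using \<mu> that by blast
  have inv: "\<mu> ((\<lambda>x. inv\<^bsub>?G\<^esub> g \<otimes>\<^bsub>?G\<^esub> x \<otimes>\<^bsub>?G\<^esub> g) ` X) = \<mu> X"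
    if "g \<in> H" "X \<subseteq> H" for g X using \<mu> that by blast
  have atomless: "\<mu> {g} = 0" if "g \<in> H" for g using \<mu> that by blast
  have HD: "strict_mono h \<and> surj h" if "h \<in> H" for h
    using subgroup.subset[OF H] that unfolding homeo_plus_UNIV_carrier by auto
  have H_comp: "h \<circ> g \<in> H" if "g \<in> H" "h \<in> H" for g h
    using subgroup.m_closed[OF H that] unfolding homeo_plus_UNIV_mult .
  have H_inv: "inv_into UNIV h \<in> H" if "h \<in> H" for h
    using subgroup.m_inv_closed[OF H that] HD[OF that] homeo_plus_UNIV_inv by metis
  have H_id: "id \<in> H" using subgroup.one_closed[OF H] unfolding homeo_plus_UNIV_one .
  have H_pow: "h ^^ k \<in> H" if "h \<in> H" for h k
    using that by (induction k) (simp_all add: H_id H_comp)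
  have H_conj: "h \<circ> g \<circ> inv_into UNIV h \<in> H" if "h \<in> H" "g \<in> H" for h g
    using that by (intro H_comp H_inv)
  have ne: "fix_frontier g \<noteq> {}" if "g \<in> H" "g \<noteq> id" for g
    using fixes_point[OF that(1)] that(2) fix_frontier_nonempty by blast
  \<comment> \<open>With products read from left to right,
    \<open>inv h \<otimes> g \<otimes> h\<close> is the function
    \<open>h \<circ> g \<circ> inv_into UNIV h\<close>.\<close>
  have inv': "\<mu> ((\<lambda>g. h \<circ> g \<circ> inv_into UNIV h) ` X) = \<mu> X" if "h \<in> H" "X \<subseteq> H" for h X
  proof -
    have "inv\<^bsub>?G\<^esub> h = inv_into UNIV h"
      using group.m_inv_consistent[OF group_homeo_plus_UNIV H that(1)] homeo_plus_UNIV_inv HD[OF that(1)]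
      by metis
    moreover have "f1 \<otimes>\<^bsub>?G\<^esub> f2 = f2 \<circ> f1" for f1 f2
      using homeo_plus_UNIV_mult by simp
    ultimately show ?thesis using inv[OF that] by (simp add: o_assoc)
  qed
  obtain c :: "nat set \<Rightarrow> bool" where c: "\<And>\<P> N. finite \<P> \<Longrightarrow> \<exists>n\<ge>N. \<forall>P\<in>\<P>. n \<in> P \<longleftrightarrow> c P"
    using free_ultrafilter_choice by blast
  define S where "S A = {g\<in>H. g \<noteq> id \<and> c (major A g)}" for A
  have SA: "\<mu> (S A) \<le> 2/5" unfolding S_def
    by (rule measure_major_le[OF HD bd ne ulf H_conj H_pow[OF f(1)] f(2,3) add nonneg total inv' c])
  have SA': "\<mu> (S A') \<le> 2/5" unfolding S_def
    by (rule measure_major_le[OF HD bd ne ulf H_conj H_pow[OF f'(1)] f'(2,3) add nonneg total inv' c])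
  \<comment> \<open>If \<open>c\<close> rejected both sets, it would be matched at one common
    \<open>n\<close>, and in that window two sets covering the line would each contain less than
    half of the frontier.\<close>
  have "H \<subseteq> S A \<union> (S A' \<union> {id})"
  proof
    fix g assume g: "g \<in> H"
    show "g \<in> S A \<union> (S A' \<union> {id})"
    proof (rule ccontr)
      assume "g \<notin> S A \<union> (S A' \<union> {id})"
      then have "\<not> c (major A g)" "\<not> c (major A' g)" using g by (auto simp: S_def)
      then obtain n where n: "n \<notin> major A g" "n \<notin> major A' g"
        using c[of "{major A g, major A' g}" 0] by auto
      let ?D = "fix_frontier g" and ?W = "{-real n..real n}"
      have "?D \<inter> ?W = (?D \<inter> A \<inter> ?W) \<union> (?D \<inter> A' \<inter> ?W)" using cover by auto
      then have "card (?D \<inter> ?W) \<le> card (?D \<inter> A \<inter> ?W) + card (?D \<inter> A' \<inter> ?W)"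
        by (metis card_Un_le)
      then show False using n by (simp add: major_def)
    qed
  qed
  have subadd: "\<mu> (Y \<union> Z) \<le> \<mu> Y + \<mu> Z" if "Y \<subseteq> H" "Z \<subseteq> H" for Y Z
  proof -
    have "\<mu> (Y \<union> (Z - Y)) = \<mu> Y + \<mu> (Z - Y)" using that by (intro additiveD[OF add]) auto
    moreover have "\<mu> ((Z - Y) \<union> (Z \<inter> Y)) = \<mu> (Z - Y) + \<mu> (Z \<inter> Y)"
      using that by (intro additiveD[OF add]) auto
    moreover have "(Z - Y) \<union> (Z \<inter> Y) = Z" "Y \<union> (Z - Y) = Y \<union> Z" by auto
    moreover have "0 \<le> \<mu> (Z \<inter> Y)" using that by (intro nonneg) auto
    ultimately show ?thesis by simp
  qed
  have sub: "S B \<subseteq> H" for B by (auto simp: S_def)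
  have "H = S A \<union> (S A' \<union> {id})" using \<open>H \<subseteq> _\<close> sub H_id by auto
  then have "1 \<le> \<mu> (S A) + (\<mu> (S A') + \<mu> {id})"
    using total subadd[of "S A" "S A' \<union> {id}"] subadd[of "S A'" "{id}"] sub H_id by simp
  then show False using SA SA' atomless[OF H_id] by simp
qed

section \<open>Uniformly piecewise affine homeomorphisms\<close>

text \<open>The gap between break points is open but affinity extends to its ends, which builds in
  continuity at isolated break points.\<close>

definition affine_off :: "real set \<Rightarrow> (real \<Rightarrow> real) \<Rightarrow> bool" where
  "affine_off B f \<longleftrightarrow>
     (\<forall>u v. u < v \<and> {u<..<v} \<inter> B = {} \<longrightarrow> (\<exists>m c. \<forall>x\<in>{u..v}. f x = m * x + c))"

definition unif_piecewise_affine :: "(real \<Rightarrow> real) \<Rightarrow> bool" where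
  "unif_piecewise_affine f \<longleftrightarrow> (\<exists>B. unif_loc_finite B \<and> affine_off B f)"

lemma affine_offD:
  assumes "affine_off B f" "u < v" "{u<..<v} \<inter> B = {}"
  obtains m c where "\<And>x. x \<in> {u..v} \<Longrightarrow> f x = m * x + c"
  using assms unfolding affine_off_def by meson

text \<open>The break points of the composite are among those of \<open>f\<close> and the preimages
  of those of \<open>g\<close>. Bounded displacement of \<open>f\<close> keeps the preimages
  uniformly locally finite.\<close>

lemma unif_piecewise_affine_comp:
  assumes f: "strict_mono f" "surj f" "bounded_displacement f" "unif_piecewise_affine f"
    and g: "unif_piecewise_affine g"
  shows "unif_piecewise_affine (g \<circ> f)"
proof -
  obtain B where B: "unif_loc_finite B" "affine_off B f"
    using f(4) by (auto simp: unif_piecewise_affine_def)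
  obtain C where C: "unif_loc_finite C" "affine_off C g"
    using g by (auto simp: unif_piecewise_affine_def)
  let ?C = "inv_into UNIV f ` C"
  have "affine_off (B \<union> ?C) (g \<circ> f)"
    unfolding affine_off_def
  proof (intro allI impI; elim conjE)
    fix u v :: real
    assume uv: "u < v" "{u<..<v} \<inter> (B \<union> ?C) = {}"
    obtain m c where mc: "\<And>x. x \<in> {u..v} \<Longrightarrow> f x = m * x + c"
      using affine_offD[OF B(2) uv(1)] uv(2) by blast
    have "{f u<..<f v} \<inter> C = {}"
    proof -
      have "y \<notin> C" if y: "y \<in> {f u<..<f v}" for y
      proof
        assume "y \<in> C"
        then have "inv_into UNIV f y \<in> ?C" by blast
        moreover have "inv_into UNIV f y \<in> {u<..<v}"
          using y f(1,2) strict_mono_less[OF f(1)] by (metis greaterThanLessThan_iff surj_f_inv_f)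
        ultimately show False using uv(2) by blast
      qed
      then show ?thesis by blast
    qed
    then obtain m' c' where mc': "\<And>y. y \<in> {f u..f v} \<Longrightarrow> g y = m' * y + c'"
      using affine_offD[OF C(2)] uv(1) strict_mono_less[OF f(1)] by metis
    have "(g \<circ> f) x = (m' * m) * x + (m' * c + c')" if "x \<in> {u..v}" for x
    proof -
      have "f x \<in> {f u..f v}" using that strict_mono_less_eq[OF f(1)] by auto
      then show ?thesis using mc' mc that by (simp add: algebra_simps)
    qed
    then show "\<exists>m c. \<forall>x\<in>{u..v}. (g \<circ> f) x = m * x + c" by blast
  qed
  moreover have "unif_loc_finite (B \<union> ?C)"
    using B(1) C(1) f(2,3) by (intro unif_loc_finite_Un unif_loc_finite_image bounded_displacement_inv)
  ultimately show ?thesis by (auto simp: unif_piecewise_affine_def)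
qed

lemma unif_piecewise_affine_inv:
  assumes f: "strict_mono f" "surj f" "bounded_displacement f" "unif_piecewise_affine f"
  shows "unif_piecewise_affine (inv_into UNIV f)"
proof -
  obtain B where B: "unif_loc_finite B" "affine_off B f"
    using f(4) by (auto simp: unif_piecewise_affine_def)
  let ?g = "inv_into UNIV f"
  have fg: "f (?g y) = y" for y using f(2) by (simp add: surj_f_inv_f)
  have g_less: "?g x < ?g y \<longleftrightarrow> x < y" for x y using strict_mono_less[OF f(1)] fg by metis
  have g_le: "?g x \<le> ?g y \<longleftrightarrow> x \<le> y" for x y using strict_mono_less_eq[OF f(1)] fg by metis
  have "affine_off (f ` B) ?g"
    unfolding affine_off_def
  proof (intro allI impI; elim conjE)
    fix u v :: real
    assume uv: "u < v" "{u<..<v} \<inter> f ` B = {}"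
    have "{?g u<..<?g v} \<inter> B = {}"
    proof -
      have "x \<notin> B" if "x \<in> {?g u<..<?g v}" for x
        using that uv(2) strict_mono_less[OF f(1)] fg by (metis IntI empty_iff greaterThanLessThan_iff imageI)
      then show ?thesis by blast
    qed
    then obtain m c where mc: "\<And>x. x \<in> {?g u..?g v} \<Longrightarrow> f x = m * x + c"
      using affine_offD[OF B(2)] uv(1) g_less by metis
    have eq: "y = m * ?g y + c" if "y \<in> {u..v}" for y
      using mc[of "?g y"] that g_le fg by auto
    have "m \<noteq> 0" using eq[of u] eq[of v] uv(1) by auto
    then have "?g y = (1 / m) * y + (- c / m)" if "y \<in> {u..v}" for y
      using eq[OF that] by (simp add: field_simps)
    then show "\<exists>m c. \<forall>x\<in>{u..v}. ?g x = m * x + c" by blast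
  qed
  then show ?thesis
    using unif_loc_finite_image[OF B(1) f(3)] by (auto simp: unif_piecewise_affine_def)
qed

lemma unif_piecewise_affine_shift:
  assumes "unif_piecewise_affine f"
  shows "unif_piecewise_affine (\<lambda>x. f (x + a) - a)"
proof -
  obtain B where B: "unif_loc_finite B" "affine_off B f"
    using assms by (auto simp: unif_piecewise_affine_def)
  have "affine_off ((\<lambda>x. x - a) ` B) (\<lambda>x. f (x + a) - a)"
    unfolding affine_off_def
  proof (intro allI impI; elim conjE)
    fix u v :: real
    assume uv: "u < v" "{u<..<v} \<inter> (\<lambda>x. x - a) ` B = {}"
    have "{u+a<..<v+a} \<inter> B = {}"
    proof -
      have "x \<notin> B" if "x \<in> {u+a<..<v+a}" for x
      proof
        assume "x \<in> B"
        then have "x - a \<in> {u<..<v} \<inter> (\<lambda>x. x - a) ` B" using that by auto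
        then show False using uv(2) by blast
      qed
      then show ?thesis by blast
    qed
    then obtain m c where mc: "\<And>x. x \<in> {u+a..v+a} \<Longrightarrow> f x = m * x + c"
      using affine_offD[OF B(2), of "u+a" "v+a"] uv(1) by auto
    have "f (x + a) - a = m * x + (m * a + c - a)" if "x \<in> {u..v}" for x
      using mc[of "x + a"] that by (simp add: algebra_simps)
    then show "\<exists>m c. \<forall>x\<in>{u..v}. f (x + a) - a = m * x + c" by blast
  qed
  moreover have "bounded_displacement (\<lambda>x. x - a)"
    by (auto simp: bounded_displacement_def)
  ultimately show ?thesis
    using unif_loc_finite_image[OF B(1)] by (auto simp: unif_piecewise_affine_def)
qed

text \<open>An affine map with two fixed points is the identity, so between two points of the frontier
  there is a break point; hence the number of break points to the left separates the points of
  the frontier.\<close>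

lemma unif_loc_finite_fix_frontier:
  assumes "unif_piecewise_affine f" and cont: "continuous_on UNIV f"
  shows "unif_loc_finite (fix_frontier f)"
proof -
  obtain B where B: "unif_loc_finite B" "affine_off B f"
    using assms by (auto simp: unif_piecewise_affine_def)
  obtain K where K: "\<And>x. finite (B \<inter> {x..x+1})" "\<And>x. card (B \<inter> {x..x+1}) \<le> K"
    using B(1) by (auto simp: unif_loc_finite_def)
  have "closed {x. f x = x}"
    using cont by (intro closed_Collect_eq) auto
  then have fixed: "f p = p" if "p \<in> fix_frontier f" for p
    using that frontier_subset_closed unfolding fix_frontier_def by blast
  have sep: "\<exists>b\<in>B. p \<le> b \<and> b < q" if pq: "p \<in> fix_frontier f" "q \<in> fix_frontier f" "p < q" for p q
  proof (rule ccontr)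
    assume none: "\<not> ?thesis"
    \<comment> \<open>The affine piece is extended to the left of \<open>p\<close>, up to the last
      break point before \<open>p\<close> or by one unit; this makes \<open>p\<close> interior to
      the fixed set.\<close>
    let ?F = "insert (p - 1) (B \<inter> {p-1..<p})"
    have "B \<inter> {p-1..<p} \<subseteq> B \<inter> {p-1..(p-1)+1}" by auto
    then have fin: "finite ?F" using K(1) finite_subset by blast
    define u where "u = Max ?F"
    have "u \<in> ?F" unfolding u_def using fin by (intro Max_in) auto
    then have "u < p" by auto
    have "{u<..<q} \<inter> B = {}"
    proof -
      have "b \<notin> B" if "u < b" "b < q" for b
      proof
        assume "b \<in> B"
        show False
        proof (cases "p \<le> b")
          case True
          then show ?thesis using none \<open>b \<in> B\<close> that by blast
        next
          case False
          have "p - 1 \<le> u" unfolding u_def using fin by simp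
          then have "b \<in> ?F" using False that \<open>b \<in> B\<close> by auto
          then have "b \<le> u" unfolding u_def using fin by simp
          then show ?thesis using that by simp
        qed
      qed
      then show ?thesis by auto
    qed
    then obtain m c where mc: "\<And>x. x \<in> {u..q} \<Longrightarrow> f x = m * x + c"
      using affine_offD[OF B(2), of u q] \<open>u < p\<close> \<open>p < q\<close> by auto
    have p: "m * p + c = p" using mc[of p] fixed[OF pq(1)] \<open>u < p\<close> \<open>p < q\<close> by auto
    have q: "m * q + c = q" using mc[of q] fixed[OF pq(2)] \<open>u < p\<close> \<open>p < q\<close> by auto
    have "(m - 1) * (q - p) = 0" using p q by (simp add: algebra_simps)
    then have m: "m = 1" using \<open>p < q\<close> by simp
    then have "c = 0" using p by simp
    then have "{u<..<q} \<subseteq> {x. f x = x}" using mc m by auto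
    then have "p \<in> interior {x. f x = x}"
      using \<open>u < p\<close> \<open>p < q\<close> by (intro interiorI[of "{u<..<q}"]) auto
    then show False using pq(1) by (simp add: fix_frontier_def frontier_def)
  qed
  have "finite (fix_frontier f \<inter> {x..x+1}) \<and> card (fix_frontier f \<inter> {x..x+1}) \<le> Suc K" for x
  proof -
    let ?D = "fix_frontier f \<inter> {x..x+1}"
    \<comment> \<open>The counts take values from 0 to \<open>K\<close>, which leaves room for
      \<open>Suc K\<close> frontier points.\<close>
    define N where "N p = card (B \<inter> {x..<p})" for p
    have fin: "finite (B \<inter> {x..<p})" if "p \<le> x + 1" for p
      using that by (intro finite_subset[OF _ K(1)[of x]]) auto
    have less: "N p < N q" if pq: "p \<in> ?D" "q \<in> ?D" "p < q" for p q
    proof -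
      obtain b where b: "b \<in> B" "p \<le> b" "b < q" using sep[OF _ _ pq(3)] pq(1,2) by blast
      have "B \<inter> {x..<p} \<subset> B \<inter> {x..<q}"
      proof
        show "B \<inter> {x..<p} \<subseteq> B \<inter> {x..<q}" using pq(3) by auto
        have "b \<in> B \<inter> {x..<q}" "b \<notin> B \<inter> {x..<p}" using b pq by auto
        then show "B \<inter> {x..<p} \<noteq> B \<inter> {x..<q}" by blast
      qed
      then show ?thesis unfolding N_def using fin[of q] pq by (intro psubset_card_mono) auto
    qed
    then have inj: "inj_on N ?D"
      by (intro linorder_inj_onI') force
    have sub: "N ` ?D \<subseteq> {..K}"
    proof
      fix k assume "k \<in> N ` ?D"
      then obtain p where p: "p \<in> ?D" "k = N p" by blast
      have "N p \<le> card (B \<inter> {x..x+1})"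
        unfolding N_def using p K(1) by (intro card_mono) auto
      then show "k \<in> {..K}" using K(2)[of x] p by simp
    qed
    show ?thesis
      using inj_on_finite[OF inj sub] card_inj_on_le[OF inj sub] by simp
  qed
  then show ?thesis by (auto simp: unif_loc_finite_def)
qed

section \<open>Cellwise maps\<close>

definition unit_homeo :: "(real \<Rightarrow> real) \<Rightarrow> bool" where
  "unit_homeo \<nu> \<longleftrightarrow> strict_mono_on unit_int \<nu> \<and> \<nu> ` unit_int = unit_int"

text \<open>Common form of \<open>zeta\<close> and \<open>chi\<close>, the latter after a shift by
  1/2. The orientations \<open>\<sigma>\<close> are arbitrary, so that mirroring
  \<open>\<nu>\<close> amounts to negating \<open>\<sigma>\<close>.\<close>

definition cellmap :: "(int \<Rightarrow> bool) \<Rightarrow> (real \<Rightarrow> real) \<Rightarrow> real \<Rightarrow> real" where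
  "cellmap \<sigma> \<nu> x = real_of_int \<lfloor>x\<rfloor> + (if \<sigma> \<lfloor>x\<rfloor> then \<nu> (frac x) else 1 - \<nu> (1 - frac x))"

lemma unit_homeo_less:
  assumes "unit_homeo \<nu>" "0 \<le> s" "s < t" "t \<le> 1"
  shows "\<nu> s < \<nu> t"
  using assms by (auto simp: unit_homeo_def intro: strict_mono_onD)

lemma unit_homeo_mem:
  assumes "unit_homeo \<nu>" "0 \<le> t" "t \<le> 1"
  shows "0 \<le> \<nu> t" "\<nu> t \<le> 1"
proof -
  have "\<nu> t \<in> \<nu> ` unit_int" using assms by auto
  then show "0 \<le> \<nu> t" "\<nu> t \<le> 1" using assms(1) by (auto simp: unit_homeo_def)
qed

lemma unit_homeo_surj:
  assumes "unit_homeo \<nu>" "0 \<le> s" "s \<le> 1"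
  obtains t where "0 \<le> t" "t \<le> 1" "\<nu> t = s"
proof -
  have "s \<in> \<nu> ` unit_int" using assms by (auto simp: unit_homeo_def)
  then show ?thesis using that by auto
qed

lemma unit_homeo_ends:
  assumes "unit_homeo \<nu>"
  shows "\<nu> 0 = 0" "\<nu> 1 = 1"
proof -
  obtain t where t: "0 \<le> t" "t \<le> 1" "\<nu> t = 0" using unit_homeo_surj[OF assms, of 0] by auto
  show "\<nu> 0 = 0"
    using unit_homeo_less[OF assms, of 0 t] unit_homeo_mem[OF assms, of 0] t by (cases "t = 0") auto
  obtain t where t: "0 \<le> t" "t \<le> 1" "\<nu> t = 1" using unit_homeo_surj[OF assms, of 1] by auto
  show "\<nu> 1 = 1"
    using unit_homeo_less[OF assms, of t 1] unit_homeo_mem[OF assms, of 1] t by (cases "t = 1") auto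
qed

lemma unit_homeo_flip:
  assumes "unit_homeo \<nu>"
  shows "unit_homeo (\<lambda>t. 1 - \<nu> (1 - t))"
proof -
  have "s \<in> (\<lambda>t. 1 - \<nu> (1 - t)) ` unit_int" if s: "s \<in> unit_int" for s
  proof -
    obtain t where "0 \<le> t" "t \<le> 1" "\<nu> t = 1 - s" using unit_homeo_surj[OF assms, of "1 - s"] s by auto
    then show ?thesis by (intro image_eqI[of _ _ "1 - t"]) auto
  qed
  then show ?thesis
    using unit_homeo_mem[OF assms] unit_homeo_less[OF assms]
    by (auto simp: unit_homeo_def intro!: strict_mono_onI)
qed

lemma unit_homeo_comp:
  assumes "unit_homeo \<nu>" "unit_homeo \<nu>'"
  shows "unit_homeo (\<nu>' \<circ> \<nu>)"
proof -
  have "(\<nu>' \<circ> \<nu>) ` unit_int = unit_int"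
    using assms unfolding unit_homeo_def image_comp[symmetric] by simp
  then show ?thesis
    using assms unit_homeo_mem[OF assms(1)] by (auto simp: unit_homeo_def strict_mono_on_def)
qed

lemma unit_homeo_cong:
  assumes "unit_homeo \<nu>" "\<And>t. t \<in> unit_int \<Longrightarrow> \<nu> t = \<nu>' t"
  shows "unit_homeo \<nu>'"
proof -
  have "\<nu> ` unit_int = \<nu>' ` unit_int" using assms(2) by (rule image_cong[OF refl])
  then show ?thesis using assms by (auto simp: unit_homeo_def strict_mono_on_def)
qed

lemma cellmap_cong:
  assumes "\<And>t. t \<in> unit_int \<Longrightarrow> \<nu> t = \<nu>' t"
  shows "cellmap \<sigma> \<nu> = cellmap \<sigma> \<nu>'"
proof
  fix x
  have "frac x \<in> unit_int" "1 - frac x \<in> unit_int"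
    using frac_ge_0[of x] frac_lt_1[of x] by auto
  then show "cellmap \<sigma> \<nu> x = cellmap \<sigma> \<nu>' x" by (simp add: cellmap_def assms)
qed

lemma cellmap_add:
  assumes "unit_homeo \<nu>" "0 \<le> t" "t \<le> 1"
  shows "cellmap \<sigma> \<nu> (of_int n + t) = of_int n + (if \<sigma> n then \<nu> t else 1 - \<nu> (1 - t))"
proof (cases "t = 1")
  case True
  then show ?thesis using unit_homeo_ends[OF assms(1)] by (simp add: cellmap_def frac_def)
next
  case False
  then have "\<lfloor>of_int n + t\<rfloor> = n" using assms by (simp add: floor_eq_iff)
  then show ?thesis by (simp add: cellmap_def frac_def)
qed

lemma cell_cases:
  fixes x :: real
  obtains n :: int and t where "x = of_int n + t" "0 \<le> t" "t < 1" "\<lfloor>x\<rfloor> = n"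
  using that[of "\<lfloor>x\<rfloor>" "frac x"] frac_ge_0[of x] frac_lt_1[of x] by (simp add: frac_def)

lemma cellmap_flip:
  "cellmap \<sigma> (\<lambda>t. 1 - \<nu> (1 - t)) = cellmap (\<lambda>n. \<not> \<sigma> n) \<nu>"
  by (auto simp: cellmap_def)

lemma cellmap_comp:
  assumes "unit_homeo \<nu>" "unit_homeo \<nu>'"
  shows "cellmap \<sigma> (\<nu>' \<circ> \<nu>) = cellmap \<sigma> \<nu>' \<circ> cellmap \<sigma> \<nu>"
proof
  fix x :: real
  obtain n t where x: "x = of_int n + t" "0 \<le> t" "t < 1" using cell_cases[of x] by blast
  show "cellmap \<sigma> (\<nu>' \<circ> \<nu>) x = (cellmap \<sigma> \<nu>' \<circ> cellmap \<sigma> \<nu>) x"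
    using x unit_homeo_mem[OF assms(1)]
      cellmap_add[OF unit_homeo_comp[OF assms], of t \<sigma> n]
      cellmap_add[OF assms(1), of t \<sigma> n] cellmap_add[OF assms(2), of "\<nu> t" \<sigma> n]
      cellmap_add[OF assms(2), of "1 - \<nu> (1 - t)" \<sigma> n]
    by auto
qed

lemma cellmap_bounds:
  assumes "unit_homeo \<nu>"
  shows "of_int \<lfloor>x\<rfloor> \<le> cellmap \<sigma> \<nu> x" "cellmap \<sigma> \<nu> x < of_int \<lfloor>x\<rfloor> + 1"
proof -
  obtain n t where x: "x = of_int n + t" "0 \<le> t" "t < 1" "\<lfloor>x\<rfloor> = n" by (rule cell_cases)
  have "0 \<le> \<nu> t" "\<nu> t < 1" "0 < \<nu> (1 - t)" "\<nu> (1 - t) \<le> 1"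
    using x unit_homeo_mem[OF assms, of t] unit_homeo_mem[OF assms, of "1 - t"] unit_homeo_ends[OF assms]
      unit_homeo_less[OF assms, of t 1] unit_homeo_less[OF assms, of 0 "1 - t"] by auto
  then show "of_int \<lfloor>x\<rfloor> \<le> cellmap \<sigma> \<nu> x" "cellmap \<sigma> \<nu> x < of_int \<lfloor>x\<rfloor> + 1"
    using cellmap_add[OF assms, of t \<sigma> n] x by auto
qed

lemma strict_mono_cellmap:
  assumes "unit_homeo \<nu>"
  shows "strict_mono (cellmap \<sigma> \<nu>)"
proof (rule strict_monoI)
  fix x y :: real assume "x < y"
  show "cellmap \<sigma> \<nu> x < cellmap \<sigma> \<nu> y"
  proof (cases "\<lfloor>x\<rfloor> = \<lfloor>y\<rfloor>")
    case True
    obtain n s where x: "x = of_int n + s" "0 \<le> s" "s < 1" "\<lfloor>x\<rfloor> = n" by (rule cell_cases)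
    obtain m t where y: "y = of_int m + t" "0 \<le> t" "t < 1" "\<lfloor>y\<rfloor> = m" by (rule cell_cases)
    have "m = n" "s < t" using True x y \<open>x < y\<close> by auto
    then show ?thesis
      using x y cellmap_add[OF assms, of s \<sigma> n] cellmap_add[OF assms, of t \<sigma> n]
        unit_homeo_less[OF assms, of s t] unit_homeo_less[OF assms, of "1 - t" "1 - s"] by auto
  next
    case False
    then have "\<lfloor>x\<rfloor> + 1 \<le> \<lfloor>y\<rfloor>" using floor_mono[of x y] \<open>x < y\<close> by linarith
    then have "real_of_int \<lfloor>x\<rfloor> + 1 \<le> of_int \<lfloor>y\<rfloor>" by linarith
    then show ?thesis
      using cellmap_bounds(2)[OF assms, of \<sigma> x] cellmap_bounds(1)[OF assms, of y \<sigma>] by linarith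
  qed
qed

lemma surj_cellmap:
  assumes "unit_homeo \<nu>"
  shows "surj (cellmap \<sigma> \<nu>)"
proof -
  have "y \<in> range (cellmap \<sigma> \<nu>)" for y
  proof -
    obtain n s where y: "y = of_int n + s" "0 \<le> s" "s < 1" using cell_cases[of y] by blast
    have "0 \<le> (if \<sigma> n then s else 1 - s)" "(if \<sigma> n then s else 1 - s) \<le> 1" using y by auto
    then obtain t where t: "0 \<le> t" "t \<le> 1" "\<nu> t = (if \<sigma> n then s else 1 - s)"
      using unit_homeo_surj[OF assms] by blast
    have "cellmap \<sigma> \<nu> (of_int n + (if \<sigma> n then t else 1 - t)) = y"
      using cellmap_add[OF assms, of "if \<sigma> n then t else 1 - t" \<sigma> n] t y by (auto split: if_splits)
    then show ?thesis by (metis rangeI)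
  qed
  then show ?thesis by auto
qed

lemma bounded_displacement_cellmap:
  assumes "unit_homeo \<nu>"
  shows "bounded_displacement (cellmap \<sigma> \<nu>)"
proof -
  have "\<bar>cellmap \<sigma> \<nu> x - x\<bar> \<le> 1" for x
    using cellmap_bounds[OF assms, where x = x and \<sigma> = \<sigma>] by linarith
  then show ?thesis by (auto simp: bounded_displacement_def)
qed

lemma unif_loc_finite_int_translate: "unif_loc_finite (range (\<lambda>n::int. of_int n + e))"
proof -
  have "range (\<lambda>n::int. of_int n + e) \<inter> {x..x+1} \<subseteq> (\<lambda>n. of_int n + e) ` {\<lceil>x - e\<rceil>..\<lceil>x - e\<rceil> + 1}" for x
  proof
    fix y assume "y \<in> range (\<lambda>n::int. of_int n + e) \<inter> {x..x+1}"
    then obtain n :: int where n: "y = of_int n + e" "x \<le> of_int n + e" "of_int n + e \<le> x + 1" by auto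
    then have "n \<in> {\<lceil>x - e\<rceil>..\<lceil>x - e\<rceil> + 1}" by (simp add: ceiling_le_iff) linarith
    then show "y \<in> (\<lambda>n. of_int n + e) ` {\<lceil>x - e\<rceil>..\<lceil>x - e\<rceil> + 1}" using n(1) by blast
  qed
  then have "finite (range (\<lambda>n::int. of_int n + e) \<inter> {x..x+1}) \<and>
      card (range (\<lambda>n::int. of_int n + e) \<inter> {x..x+1}) \<le> card {\<lceil>x - e\<rceil>..\<lceil>x - e\<rceil> + 1}" for x
    by (meson finite_atLeastAtMost_int finite_surj surj_card_le)
  then show ?thesis unfolding unif_loc_finite_def by auto
qed

lemma unif_piecewise_affine_cellmap:
  assumes \<nu>: "unit_homeo \<nu>" and "piecewise_linear \<nu>"
  shows "unif_piecewise_affine (cellmap \<sigma> \<nu>)"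
proof -
  obtain D where D: "finite D" and lin: "\<And>u v. 0 \<le> u \<and> u < v \<and> v \<le> 1 \<and> {u<..<v} \<inter> D = {} \<Longrightarrow>
           (\<exists>m c. \<forall>x \<in> {u..v}. \<nu> x = m * x + c)"
    using assms(2) unfolding piecewise_linear_def by metis
  \<comment> \<open>Possible break points of a cell in either orientation: those of
    \<open>\<nu>\<close>, their mirror images, and 0 for the integer ends. One finite set serves all
    cells, whence the uniform bound.\<close>
  define E where "E = insert 0 (D \<union> (\<lambda>d. 1 - d) ` D)"
  define B where "B = (\<Union>e\<in>E. range (\<lambda>n::int. of_int n + e))"
  have "finite E" using D by (simp add: E_def)
  then have "unif_loc_finite B"
    unfolding B_def by (rule unif_loc_finite_UN) (rule unif_loc_finite_int_translate)
  moreover have "affine_off B (cellmap \<sigma> \<nu>)"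
    unfolding affine_off_def
  proof (intro allI impI; elim conjE)
    fix u v :: real
    assume uv: "u < v" "{u<..<v} \<inter> B = {}"
    obtain n s where u: "u = of_int n + s" "0 \<le> s" "s < 1" using cell_cases[of u] by blast
    have B_mem: "of_int k + e \<in> B" if "e \<in> E" for k e using that by (auto simp: B_def)
    have "of_int (n + 1) + 0 \<in> B" by (rule B_mem) (simp add: E_def)
    then have "of_int (n + 1) + 0 \<notin> {u<..<v}" using uv(2) by blast
    then have "v \<le> of_int n + 1" using u by auto
    define t where "t = v - of_int n"
    have v: "v = of_int n + t" "s < t" "t \<le> 1"
      using \<open>v \<le> of_int n + 1\<close> uv(1) u(1) by (auto simp: t_def)
    have no: "of_int n + e \<notin> {u<..<v}" if "e \<in> E" for e
      using B_mem[OF that, of n] uv(2) by blast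
    have cell: "x - of_int n \<in> {s..t}" "cellmap \<sigma> \<nu> x = of_int n + (if \<sigma> n then \<nu> (x - of_int n) else 1 - \<nu> (1 - (x - of_int n)))"
      if "x \<in> {u..v}" for x
      using that u v cellmap_add[OF \<nu>, of "x - of_int n" \<sigma> n] by auto
    show "\<exists>m c. \<forall>x\<in>{u..v}. cellmap \<sigma> \<nu> x = m * x + c"
    proof (cases "\<sigma> n")
      case True
      have "{s<..<t} \<inter> D = {}"
        using no u v by (auto simp: E_def)
      then obtain m c where mc: "\<forall>x \<in> {s..t}. \<nu> x = m * x + c" using lin[of s t] u v by auto
      have "cellmap \<sigma> \<nu> x = m * x + (of_int n - m * of_int n + c)" if "x \<in> {u..v}" for x
        using cell[OF that] mc True by (simp add: algebra_simps)
      then show ?thesis by blast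
    next
      case False
      have "d \<notin> D" if "1 - t < d" "d < 1 - s" for d
        using no[of "1 - d"] that u v by (auto simp: E_def)
      then have "{1-t<..<1-s} \<inter> D = {}" by auto
      then obtain m c where mc: "\<forall>x \<in> {1-t..1-s}. \<nu> x = m * x + c" using lin[of "1-t" "1-s"] u v by auto
      have "cellmap \<sigma> \<nu> x = m * x + (of_int n + 1 - m * (1 + of_int n) - c)" if "x \<in> {u..v}" for x
        using cell[OF that] bspec[OF mc, of "1 - (x - of_int n)"] False by (simp add: algebra_simps)
      then show ?thesis by blast
    qed
  qed
  ultimately show ?thesis by (auto simp: unif_piecewise_affine_def)
qed

text \<open>The reflection sends cell number n to cell number c - n - 1 and reverses it; opposite
  orientations of the two cells make up for the reversal.\<close>

lemma cellmap_point_reflection: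
  assumes "unit_homeo \<nu>" "\<sigma> (c - \<lfloor>x\<rfloor> - 1) \<longleftrightarrow> \<not> \<sigma> \<lfloor>x\<rfloor>"
  shows "cellmap \<sigma> \<nu> (of_int c - x) = of_int c - cellmap \<sigma> \<nu> x"
proof -
  obtain n t where x: "x = of_int n + t" "0 \<le> t" "t < 1" "\<lfloor>x\<rfloor> = n" by (rule cell_cases)
  have eq: "of_int c - x = of_int (c - n - 1) + (1 - t)" using x by simp
  have "cellmap \<sigma> \<nu> (of_int c - x) =
      of_int (c - n - 1) + (if \<sigma> (c - n - 1) then \<nu> (1 - t) else 1 - \<nu> t)"
    unfolding eq using cellmap_add[OF assms(1), of "1 - t" \<sigma> "c - n - 1"] x(2,3) by simp
  moreover have "cellmap \<sigma> \<nu> x = of_int n + (if \<sigma> n then \<nu> t else 1 - \<nu> (1 - t))"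
    using cellmap_add[OF assms(1), of t \<sigma> n] x by simp
  ultimately show ?thesis using assms(2) x(4) by auto
qed

section \<open>Translates of cellwise maps\<close>

definition shifted :: "real \<Rightarrow> (real \<Rightarrow> real) \<Rightarrow> real \<Rightarrow> real" where
  "shifted a f x = f (x + a) - a"

lemma shifted_comp: "shifted a (g \<circ> f) = shifted a g \<circ> shifted a f"
  by (auto simp: shifted_def)

lemma strict_mono_shifted: "strict_mono f \<Longrightarrow> strict_mono (shifted a f)"
  by (auto simp: shifted_def strict_mono_def)

lemma surj_shifted:
  assumes "surj f"
  shows "surj (shifted a f)"
proof -
  have "y \<in> range (shifted a f)" for y
  proof -
    obtain x where "f x = y + a" using assms by (metis surjD)
    then have "shifted a f (x - a) = y" by (simp add: shifted_def)
    then show ?thesis by (metis rangeI)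
  qed
  then show ?thesis by auto
qed

lemma bounded_displacement_shifted:
  assumes "bounded_displacement f"
  shows "bounded_displacement (shifted a f)"
proof -
  obtain C where C: "\<bar>f x - x\<bar> \<le> C" for x using assms by (auto simp: bounded_displacement_def)
  have "\<bar>shifted a f x - x\<bar> \<le> C" for x using C[of "x + a"] by (simp add: shifted_def algebra_simps)
  then show ?thesis by (auto simp: bounded_displacement_def)
qed

lemma shifted_cellmap_wandering:
  assumes \<nu>: "unit_homeo \<nu>" "\<nu> (1/4) > 3/4" "\<And>t. t \<in> unit_int \<Longrightarrow> t \<le> \<nu> t"
  obtains P where "shifted a (cellmap \<sigma> \<nu>) ` ({x. frac (x + a) \<in> {1/4..3/4}} \<union> P) \<subseteq> P"
    "{x. frac (x + a) \<in> {1/4..3/4}} \<inter> P = {}"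
proof -
  \<comment> \<open>In the coordinate \<open>x + a\<close>, a cell acted on by \<open>\<nu>\<close>
    has its middle half pushed into the right quarter, a mirrored cell into the left quarter. The
    fixed ends of the cells are left out.\<close>
  define P where "P = {x. frac (x + a) \<in> (if \<sigma> \<lfloor>x + a\<rfloor> then {3/4<..<1} else {0<..<1/4})}"
  show ?thesis
  proof (rule that[of P])
    show "{x. frac (x + a) \<in> {1/4..3/4}} \<inter> P = {}"
      by (auto simp: P_def split: if_splits)
    have up: "3/4 < \<nu> t \<and> \<nu> t < 1" if "1/4 \<le> t" "t < 1" for t
    proof -
      have "1/4 = t \<or> 1/4 < t" using that by linarith
      then have "\<nu> (1/4) \<le> \<nu> t"
        using unit_homeo_less[OF \<nu>(1), of "1/4" t] that(2) by (elim disjE) (simp only: order_refl, simp)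
      moreover have "\<nu> t < 1"
        using unit_homeo_less[OF \<nu>(1), of t 1] unit_homeo_ends[OF \<nu>(1)] that by simp
      ultimately show ?thesis using \<nu>(2) by linarith
    qed
    have "shifted a (cellmap \<sigma> \<nu>) x \<in> P"
      if x: "x \<in> {x. frac (x + a) \<in> {1/4..3/4}} \<union> P" for x
    proof -
      obtain n t where nt: "x + a = of_int n + t" "0 \<le> t" "t < 1" "\<lfloor>x + a\<rfloor> = n" by (rule cell_cases)
      then have t: "frac (x + a) = t" by (simp add: frac_def)
      define s where "s = (if \<sigma> n then \<nu> t else 1 - \<nu> (1 - t))"
      have eq: "shifted a (cellmap \<sigma> \<nu>) x + a = of_int n + s"
        using cellmap_add[OF \<nu>(1), of t \<sigma> n] nt by (simp add: shifted_def s_def)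
      have s: "s \<in> (if \<sigma> n then {3/4<..<1} else {0<..<1/4})"
      proof (cases "\<sigma> n")
        case True
        then have "1/4 \<le> t" using x nt t by (auto simp: P_def)
        then show ?thesis using up[of t] nt True by (simp add: s_def)
      next
        case False
        then have "1/4 \<le> 1 - t" "1 - t < 1" using x nt t by (auto simp: P_def)
        then show ?thesis using up[of "1 - t"] False by (simp add: s_def)
      qed
      then have "\<lfloor>of_int n + s\<rfloor> = n" by (auto simp: floor_eq_iff split: if_splits)
      then have "\<lfloor>shifted a (cellmap \<sigma> \<nu>) x + a\<rfloor> = n" "frac (shifted a (cellmap \<sigma> \<nu>) x + a) = s"
        unfolding eq frac_def by simp_all
      then show ?thesis using s by (simp add: P_def)
    qed
    then show "shifted a (cellmap \<sigma> \<nu>) ` ({x. frac (x + a) \<in> {1/4..3/4}} \<union> P) \<subseteq> P" by blast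
  qed
qed

section \<open>Reflections of the labelling\<close>

text \<open>Stands in for locality: what an element of the group does at \<open>x\<close> depends
  only on the labels within a distance that is uniform in \<open>x\<close>. Only the consequence for
  reflections is recorded; the centre of y \<mapsto> c - y is c/2.\<close>

definition reflection_equivariant :: "(real \<Rightarrow> letter) \<Rightarrow> (real \<Rightarrow> real) \<Rightarrow> bool" where
  "reflection_equivariant \<rho> f \<longleftrightarrow>
     (\<exists>r. \<forall>c\<in>half_ints. \<forall>x.
        (\<forall>y\<in>half_ints. \<bar>y - x\<bar> \<le> r \<longrightarrow> \<rho> (c - y) = inv_letter (\<rho> y)) \<longrightarrow> f (c - x) = c - f x)"

lemma reflection_equivariantE:
  assumes "reflection_equivariant \<rho> f"
  obtains r where "\<And>c x. c \<in> half_ints \<Longrightarrow>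
      (\<And>y. y \<in> half_ints \<Longrightarrow> \<bar>y - x\<bar> \<le> r \<Longrightarrow> \<rho> (c - y) = inv_letter (\<rho> y)) \<Longrightarrow> f (c - x) = c - f x"
  using assms unfolding reflection_equivariant_def by meson

lemma reflection_equivariant_comp:
  assumes "reflection_equivariant \<rho> f" "reflection_equivariant \<rho> g" "bounded_displacement f"
  shows "reflection_equivariant \<rho> (g \<circ> f)"
proof -
  obtain r where r: "\<And>c x. c \<in> half_ints \<Longrightarrow>
      (\<And>y. y \<in> half_ints \<Longrightarrow> \<bar>y - x\<bar> \<le> r \<Longrightarrow> \<rho> (c - y) = inv_letter (\<rho> y)) \<Longrightarrow> f (c - x) = c - f x"
    using reflection_equivariantE[OF assms(1)] by blast
  obtain s where s: "\<And>c x. c \<in> half_ints \<Longrightarrow>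
      (\<And>y. y \<in> half_ints \<Longrightarrow> \<bar>y - x\<bar> \<le> s \<Longrightarrow> \<rho> (c - y) = inv_letter (\<rho> y)) \<Longrightarrow> g (c - x) = c - g x"
    using reflection_equivariantE[OF assms(2)] by blast
  obtain C where C: "\<And>x. \<bar>f x - x\<bar> \<le> C" using bounded_displacementE[OF assms(3)] by blast
  show ?thesis
    unfolding reflection_equivariant_def
  \<comment> \<open>The second map acts at \<open>f x\<close>, so its radius is enlarged by the
    displacement \<open>C\<close> of the first.\<close>
  proof (intro exI[of _ "max r (s + C)"] ballI allI impI)
    fix c x assume c: "c \<in> half_ints"
      and *: "\<forall>y\<in>half_ints. \<bar>y - x\<bar> \<le> max r (s + C) \<longrightarrow> \<rho> (c - y) = inv_letter (\<rho> y)"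
    have f: "f (c - x) = c - f x" using * by (intro r[OF c]) auto
    have "g (c - f x) = c - g (f x)"
    proof (rule s[OF c])
      fix y assume y: "y \<in> half_ints" "\<bar>y - f x\<bar> \<le> s"
      then have "\<bar>y - x\<bar> \<le> max r (s + C)" using C[of x] by linarith
      then show "\<rho> (c - y) = inv_letter (\<rho> y)" using * y by blast
    qed
    then show "(g \<circ> f) (c - x) = c - (g \<circ> f) x" by (simp add: f)
  qed
qed

lemma reflection_equivariant_inv:
  assumes f: "reflection_equivariant \<rho> f" "bounded_displacement f" "inj f" "surj f"
  shows "reflection_equivariant \<rho> (inv_into UNIV f)"
proof -
  obtain r where r: "\<And>c x. c \<in> half_ints \<Longrightarrow>
      (\<And>y. y \<in> half_ints \<Longrightarrow> \<bar>y - x\<bar> \<le> r \<Longrightarrow> \<rho> (c - y) = inv_letter (\<rho> y)) \<Longrightarrow> f (c - x) = c - f x"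
    using reflection_equivariantE[OF assms(1)] by blast
  obtain C where C: "\<And>x. \<bar>f x - x\<bar> \<le> C" using bounded_displacementE[OF f(2)] by blast
  show ?thesis
    unfolding reflection_equivariant_def
  proof (intro exI[of _ "r + C"] ballI allI impI)
    fix c x assume c: "c \<in> half_ints"
      and *: "\<forall>y\<in>half_ints. \<bar>y - x\<bar> \<le> r + C \<longrightarrow> \<rho> (c - y) = inv_letter (\<rho> y)"
    define z where "z = inv_into UNIV f x"
    have z: "f z = x" unfolding z_def using f(4) by (rule surj_f_inv_f)
    have "f (c - z) = c - f z"
    proof (rule r[OF c])
      fix y assume y: "y \<in> half_ints" "\<bar>y - z\<bar> \<le> r"
      then have "\<bar>y - x\<bar> \<le> r + C" using C[of z] z by linarith
      then show "\<rho> (c - y) = inv_letter (\<rho> y)" using * y by blast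
    qed
    then have "inv_into UNIV f (c - x) = c - z" using z inv_f_f[OF f(3)] by metis
    then show "inv_into UNIV f (c - x) = c - inv_into UNIV f x" by (simp add: z_def)
  qed
qed

section \<open>Half-integers\<close>

lemma half_ints_diff:
  assumes "x \<in> half_ints" "y \<in> half_ints"
  shows "x - y \<in> half_ints"
proof -
  obtain k l :: int where "x = of_int k / 2" "y = of_int l / 2" using assms by (auto simp: half_ints_def)
  then have "x - y = of_int (k - l) / 2" by (simp add: diff_divide_distrib)
  then show ?thesis unfolding half_ints_def by blast
qed

lemma half_ints_add:
  assumes "x \<in> half_ints" "y \<in> half_ints"
  shows "x + y \<in> half_ints"
proof -
  obtain k l :: int where "x = of_int k / 2" "y = of_int l / 2" using assms by (auto simp: half_ints_def)
  then have "x + y = of_int (k + l) / 2" by (simp add: add_divide_distrib)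
  then show ?thesis unfolding half_ints_def by blast
qed

lemma half_ints_nat: "real i / 2 \<in> half_ints"
  unfolding half_ints_def by (metis (mono_tags) mem_Collect_eq of_int_of_nat_eq)

lemma int_in_half_ints: "of_int n \<in> half_ints"
  unfolding half_ints_def by (rule CollectI, rule exI[of _ "2 * n"]) simp

lemma int_plus_half_in_half_ints: "of_int n + 1/2 \<in> half_ints"
  unfolding half_ints_def by (rule CollectI, rule exI[of _ "2 * n + 1"]) simp

lemma int_plus_half_not_Ints: "of_int n + 1/2 \<notin> (\<int> :: real set)"
proof
  assume "of_int n + 1/2 \<in> (\<int> :: real set)"
  then obtain m where "of_int n + 1/2 = (of_int m :: real)" by (auto elim: Ints_cases)
  then have "of_int (2 * n + 1) = (of_int (2 * m) :: real)" by simp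
  then have "2 * n + 1 = 2 * m" by (simp only: of_int_eq_iff)
  then show False by presburger
qed

text \<open>Inverting a letter preserves its type, which tells integers from other half-integers.\<close>

lemma reflection_centre_int:
  assumes \<rho>: "labelling \<rho>" and c: "c \<in> half_ints"
    and inv: "\<rho> (c - of_int n) = inv_letter (\<rho> (of_int n))"
  obtains m :: int where "c = of_int m"
proof -
  have "\<rho> (of_int n) \<in> {Let_a, Let_a_inv}" using \<rho> by (auto simp: labelling_def)
  then have "\<rho> (c - of_int n) \<in> {Let_a, Let_a_inv}" using inv by auto
  moreover have "\<rho> (c - of_int n) \<in> {Let_b, Let_b_inv}" if "c - of_int n \<notin> \<int>"
    using \<rho> that half_ints_diff[OF c int_in_half_ints[of n]] unfolding labelling_def by blast
  ultimately have "c - of_int n \<in> \<int>"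
    by (metis insert_iff letter.distinct empty_iff)
  then obtain k where "c - of_int n = of_int k" by (rule Ints_cases)
  then show ?thesis using that[of "k + n"] by simp
qed

section \<open>The generators as cellwise maps and their behaviour under reflections\<close>

lemma zeta_eq_cellmap:
  assumes "unit_homeo \<nu>"
  shows "zeta \<rho> \<nu> = shifted 0 (cellmap (\<lambda>n. \<rho> (of_int n + 1/2) = Let_b) \<nu>)"
proof
  fix x :: real
  have "\<nu> ` unit_int \<subseteq> unit_int" "frac x \<in> unit_int"
    using assms frac_ge_0[of x] frac_lt_1[of x] by (auto simp: unit_homeo_def)
  from reflect_apply[OF this]
  show "zeta \<rho> \<nu> x = shifted 0 (cellmap (\<lambda>n. \<rho> (of_int n + 1/2) = Let_b) \<nu>) x"
    by (simp add: zeta_def shifted_def cellmap_def Let_def frac_def)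
qed

lemma chi_eq_cellmap:
  assumes "unit_homeo \<nu>"
  shows "chi \<rho> \<nu> = shifted (1/2) (cellmap (\<lambda>n. \<rho> (of_int n) = Let_a) \<nu>)"
proof
  fix x :: real
  have "\<nu> ` unit_int \<subseteq> unit_int" "frac (x + 1/2) \<in> unit_int"
    using assms frac_ge_0[of "x + 1/2"] frac_lt_1[of "x + 1/2"] by (auto simp: unit_homeo_def)
  from reflect_apply[OF this]
  show "chi \<rho> \<nu> x = shifted (1/2) (cellmap (\<lambda>n. \<rho> (of_int n) = Let_a) \<nu>) x"
    by (simp add: chi_def shifted_def cellmap_def Let_def frac_def algebra_simps)
qed

lemma reflection_equivariant_zeta:
  assumes \<rho>: "labelling \<rho>" and \<nu>: "unit_homeo \<nu>"
  shows "reflection_equivariant \<rho> (zeta \<rho> \<nu>)"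
  unfolding reflection_equivariant_def
\<comment> \<open>Radius 1 reaches the integer n = \<lfloor>x\<rfloor>, whose letter forces
  \<open>c\<close> to be an integer, and n + 1/2, whose letter orients the cell.\<close>
proof (intro exI[of _ 1] ballI allI impI)
  fix c x :: real
  assume c: "c \<in> half_ints" and *: "\<forall>y\<in>half_ints. \<bar>y - x\<bar> \<le> 1 \<longrightarrow> \<rho> (c - y) = inv_letter (\<rho> y)"
  define n where "n = \<lfloor>x\<rfloor>"
  have n: "of_int n \<le> x" "x < of_int n + 1" by (auto simp: n_def)
  have "\<rho> (c - of_int n) = inv_letter (\<rho> (of_int n))" using * int_in_half_ints n by auto
  then obtain m where m: "c = of_int m" using reflection_centre_int[OF \<rho> c] by blast
  have "\<rho> (of_int n + 1/2) \<in> {Let_b, Let_b_inv}"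
    using \<rho> int_plus_half_in_half_ints[of n] int_plus_half_not_Ints[of n] unfolding labelling_def by blast
  moreover have "\<rho> (c - (of_int n + 1/2)) = inv_letter (\<rho> (of_int n + 1/2))"
    using bspec[OF *] int_plus_half_in_half_ints[of n] n by auto
  moreover have "c - (of_int n + 1/2) = of_int (m - n - 1) + 1/2" by (simp add: m)
  ultimately have "\<rho> (of_int (m - n - 1) + 1/2) = Let_b \<longleftrightarrow> \<rho> (of_int n + 1/2) \<noteq> Let_b" by auto
  then show "zeta \<rho> \<nu> (c - x) = c - zeta \<rho> \<nu> x"
    using cellmap_point_reflection[OF \<nu>, of "\<lambda>n. \<rho> (of_int n + 1/2) = Let_b" m x]
    by (simp add: zeta_eq_cellmap[OF \<nu>] shifted_def m n_def)
qed

lemma reflection_equivariant_chi: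
  assumes \<rho>: "labelling \<rho>" and \<nu>: "unit_homeo \<nu>"
  shows "reflection_equivariant \<rho> (chi \<rho> \<nu>)"
  unfolding reflection_equivariant_def
proof (intro exI[of _ 1] ballI allI impI)
  fix c x :: real
  assume c: "c \<in> half_ints" and *: "\<forall>y\<in>half_ints. \<bar>y - x\<bar> \<le> 1 \<longrightarrow> \<rho> (c - y) = inv_letter (\<rho> y)"
  define n where "n = \<lfloor>x + 1/2\<rfloor>"
  have n: "of_int n \<le> x + 1/2" "x + 1/2 < of_int n + 1" by (auto simp: n_def)
  have inv: "\<rho> (c - of_int n) = inv_letter (\<rho> (of_int n))"
    using bspec[OF *] int_in_half_ints[of n] n by auto
  then obtain m where m: "c = of_int m" using reflection_centre_int[OF \<rho> c] by blast
  have "\<rho> (of_int n) \<in> {Let_a, Let_a_inv}" using \<rho> by (auto simp: labelling_def)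
  then have "\<rho> (of_int (m + 1 - n - 1)) = Let_a \<longleftrightarrow> \<rho> (of_int n) \<noteq> Let_a"
    using inv by (auto simp: m)
  \<comment> \<open>In the shifted coordinate the constant of the reflection is c + 1, since (c - x)
    + 1/2 = (c + 1) - (x + 1/2).\<close>
  then have A: "cellmap (\<lambda>n. \<rho> (of_int n) = Let_a) \<nu> (of_int (m + 1) - (x + 1/2)) =
      of_int (m + 1) - cellmap (\<lambda>n. \<rho> (of_int n) = Let_a) \<nu> (x + 1/2)"
    unfolding n_def by (intro cellmap_point_reflection[OF \<nu>])
  have B: "of_int (m + 1) - (x + 1/2) = c - x + 1/2" by (simp add: m)
  have "cellmap (\<lambda>n. \<rho> (of_int n) = Let_a) \<nu> (c - x + 1/2) =
      c + 1 - cellmap (\<lambda>n. \<rho> (of_int n) = Let_a) \<nu> (x + 1/2)"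
    using A unfolding B by (simp add: m)
  then show "chi \<rho> \<nu> (c - x) = c - chi \<rho> \<nu> x"
    by (simp add: chi_eq_cellmap[OF \<nu>] shifted_def)
qed

section \<open>Words of blocks and the existence of fixed points\<close>

lemma block_word_eq:
  "block_word \<rho> ((\<lambda>i. k + real i / 2) ` {0..n}) = map (\<lambda>i. \<rho> (k + real i / 2)) [0..<Suc n]"
proof -
  let ?xs = "map (\<lambda>i. k + real i / 2) [0..<Suc n]"
  have "sorted_wrt (<) ?xs" by (simp add: sorted_wrt_map sorted_wrt_upt del: upt_Suc)
  moreover have "(\<lambda>i. k + real i / 2) ` {0..n} = set ?xs"
    by (auto simp del: upt_Suc simp: atLeastLessThanSuc_atLeastAtMost)
  ultimately have "sorted_list_of_set ((\<lambda>i. k + real i / 2) ` {0..n}) = ?xs"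
    by (metis sorted_list_of_set.idem_if_sorted_distinct strict_sorted_iff)
  then show ?thesis by (simp add: block_word_def del: upt_Suc)
qed

text \<open>By condition (2) of quasi-periodicity, the labels on any interval around \<open>0\<close> are
  inverted by a reflection; so if \<open>f\<close> moves \<open>0\<close> to the right, it moves the mirror image of
  \<open>0\<close> to the left.\<close>

lemma reflection_equivariant_fixed_point:
  assumes qp: "quasi_periodic \<rho>" and f: "reflection_equivariant \<rho> f" and cont: "continuous_on UNIV f"
  shows "\<exists>x. f x = x"
proof -
  obtain r where r: "\<And>c x. c \<in> half_ints \<Longrightarrow>
      (\<And>y. y \<in> half_ints \<Longrightarrow> \<bar>y - x\<bar> \<le> r \<Longrightarrow> \<rho> (c - y) = inv_letter (\<rho> y)) \<Longrightarrow> f (c - x) = c - f x"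
    using reflection_equivariantE[OF f] by blast
  define N where "N = nat \<lceil>r\<rceil>"
  have N: "r \<le> real N" unfolding N_def by (rule real_nat_ceiling_ge)
  define k where "k = real_of_int (- int N)"
  have k: "k \<in> half_ints" unfolding k_def by (rule int_in_half_ints)
  \<comment> \<open>These are the \<open>4 * N + 1\<close> half-integers in [-N,N].\<close>
  define X where "X = (\<lambda>i. k + real i / 2) ` {0..4 * N}"
  have "is_block X" using k by (auto simp: is_block_def X_def)
  then obtain Y where "is_block Y" and Y: "block_word \<rho> Y = inv_word (block_word \<rho> X)"
    using qp by (auto simp: quasi_periodic_def)
  then obtain l m where l: "l \<in> half_ints" and Y_eq: "Y = (\<lambda>i. l + real i / 2) ` {0..m}"
    by (auto simp: is_block_def)
  have words: "map (\<lambda>i. \<rho> (l + real i / 2)) [0..<Suc m] =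
      map inv_letter (rev (map (\<lambda>i. \<rho> (k + real i / 2)) [0..<Suc (4 * N)]))"
    using Y unfolding X_def Y_eq block_word_eq inv_word_def .
  have m: "m = 4 * N" using arg_cong[OF words, of length] by simp
  have letters: "\<rho> (l + real i / 2) = inv_letter (\<rho> (k + real (4 * N - i) / 2))" if "i \<le> 4 * N" for i
  proof -
    have "map (\<lambda>i. \<rho> (l + real i / 2)) [0..<Suc m] ! i = \<rho> (l + real i / 2)"
      using that m by (simp del: upt_Suc)
    moreover have "[0..<Suc (4 * N)] ! (4 * N - i) = 4 * N - i" by (subst nth_upt) auto
    then have "map inv_letter (rev (map (\<lambda>i. \<rho> (k + real i / 2)) [0..<Suc (4 * N)])) ! i
        = inv_letter (\<rho> (k + real (4 * N - i) / 2))"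
      using that by (simp del: upt_Suc add: rev_nth)
    ultimately show ?thesis using words by simp
  qed
  \<comment> \<open>Position \<open>i\<close> in \<open>Y\<close> is matched with position
    \<open>4 * N - i\<close> in \<open>X\<close>; the two points always add up to
    \<open>c\<close>.\<close>
  define c where "c = k + l + real (4 * N) / 2"
  have c: "c \<in> half_ints" unfolding c_def by (intro half_ints_add k l half_ints_nat)
  have refl: "\<rho> (c - y) = inv_letter (\<rho> y)" if y: "y \<in> half_ints" "\<bar>y - 0\<bar> \<le> r" for y
  proof -
    obtain j :: int where j: "y = of_int j / 2" using y by (auto simp: half_ints_def)
    have "\<bar>y\<bar> \<le> real N" using y N by simp
    then have "\<bar>real_of_int j\<bar> \<le> real_of_int (2 * int N)" by (simp add: j)
    then have j_le: "\<bar>j\<bar> \<le> 2 * int N" by linarith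
    define i where "i = nat (2 * int N - j)"
    have i: "i \<le> 4 * N" "real i = 2 * real N - real_of_int j" using j_le by (auto simp: i_def nat_le_iff)
    have "l + real i / 2 = c - y" using i by (simp add: c_def k_def j field_simps)
    moreover have "k + real (4 * N - i) / 2 = y" using i by (simp add: k_def j of_nat_diff field_simps)
    ultimately show ?thesis using letters[OF i(1)] by simp
  qed
  have fc: "f c = c - f 0" using r[OF c, of 0] refl by simp
  define d where "d x = f x - x" for x
  have cont_d: "continuous_on S d" for S
    unfolding d_def using continuous_on_subset[OF cont] by (intro continuous_intros) auto
  have dc: "d c = - d 0" using fc by (simp add: d_def)
  \<comment> \<open>\<open>d\<close> takes opposite values at 0 and \<open>c\<close>. Either point
    may be the smaller, so the intermediate value theorem is applied between minimum and
    maximum.\<close>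
  have "\<exists>x. d x = 0"
  proof (cases "d (min 0 c) \<le> 0")
    case True
    then have "0 \<le> d (max 0 c)" using dc by (auto simp: min_def max_def split: if_splits)
    then show ?thesis
      using IVT'[of d "min 0 c" 0 "max 0 c", OF True _ _ cont_d] by (meson max.cobounded1 min.cobounded1 order_trans)
  next
    case False
    then have "d (max 0 c) \<le> 0" using dc by (auto simp: min_def max_def split: if_splits)
    then show ?thesis
      using IVT2'[of d "max 0 c" 0 "min 0 c", OF _ _ _ cont_d] False
      by (meson linear max.cobounded1 min.cobounded1 order_trans)
  qed
  then show ?thesis by (auto simp: d_def)
qed

section \<open>The group generated by the cellwise maps\<close>

text \<open>Collecting the properties in one subgroup reduces their verification to the generators.
  They travel together: the closure arguments for the last two use bounded displacement.\<close>

definition tame :: "(real \<Rightarrow> letter) \<Rightarrow> (real \<Rightarrow> real) set" where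
  "tame \<rho> = {f. strict_mono f \<and> surj f \<and> bounded_displacement f \<and> unif_piecewise_affine f \<and>
     reflection_equivariant \<rho> f}"

lemma subgroup_tame: "subgroup (tame \<rho>) (homeo_plus UNIV)"
proof (rule subgroup.intro)
  show "tame \<rho> \<subseteq> carrier (homeo_plus UNIV)"
    unfolding homeo_plus_UNIV_carrier by (auto simp: tame_def)
next
  fix f g assume "f \<in> tame \<rho>" "g \<in> tame \<rho>"
  then show "f \<otimes>\<^bsub>homeo_plus UNIV\<^esub> g \<in> tame \<rho>"
    unfolding homeo_plus_UNIV_mult tame_def
    using unif_piecewise_affine_comp bounded_displacement_comp reflection_equivariant_comp
      comp_surj strict_mono_o by blast
next
  have "bounded_displacement id" by (auto simp: bounded_displacement_def)
  moreover have "affine_off {} id" unfolding affine_off_def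
    by (intro allI impI exI[of _ 1] exI[of _ 0]) auto
  then have "unif_piecewise_affine id"
    by (auto simp: unif_piecewise_affine_def unif_loc_finite_def intro!: exI[of _ "{}"])
  ultimately show "\<one>\<^bsub>homeo_plus UNIV\<^esub> \<in> tame \<rho>"
    unfolding homeo_plus_UNIV_one by (auto simp: tame_def reflection_equivariant_def strict_mono_def)
next
  fix f assume f: "f \<in> tame \<rho>"
  then have "inv\<^bsub>homeo_plus UNIV\<^esub> f = inv_into UNIV f"
    by (intro homeo_plus_UNIV_inv) (auto simp: tame_def)
  moreover have "inv_into UNIV f \<in> tame \<rho>"
    using f strict_mono_inv[of f] bounded_displacement_inv[of f] unif_piecewise_affine_inv[of f]
      reflection_equivariant_inv[of \<rho> f] strict_mono_imp_inj_on[of f UNIV]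
    by (simp only: tame_def mem_Collect_eq simp_thms)
  ultimately show "inv\<^bsub>homeo_plus UNIV\<^esub> f \<in> tame \<rho>" by simp
qed

lemma zeta_chi_tame:
  assumes "labelling \<rho>" and \<nu>: "unit_homeo \<nu>" and "\<And>\<sigma>. unif_piecewise_affine (cellmap \<sigma> \<nu>)"
  shows "zeta \<rho> \<nu> \<in> tame \<rho>" "chi \<rho> \<nu> \<in> tame \<rho>"
proof -
  have "unif_piecewise_affine (shifted a (cellmap \<sigma> \<nu>))" for a \<sigma>
    unfolding shifted_def[abs_def] using assms(3) by (rule unif_piecewise_affine_shift)
  then show "zeta \<rho> \<nu> \<in> tame \<rho>" "chi \<rho> \<nu> \<in> tame \<rho>"
    using reflection_equivariant_zeta[OF assms(1,2)] reflection_equivariant_chi[OF assms(1,2)]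
    unfolding tame_def zeta_eq_cellmap[OF \<nu>] chi_eq_cellmap[OF \<nu>]
    by (auto simp only: mem_Collect_eq simp_thms \<nu> strict_mono_shifted strict_mono_cellmap surj_shifted
        surj_cellmap bounded_displacement_shifted bounded_displacement_cellmap)
qed

text \<open>For fixed orientations,
  \<open>\<nu> \<mapsto> shifted a (cellmap \<sigma> \<nu>)\<close> is a homomorphism. This reaches
  elements of the generated group that are not given as explicit words.\<close>

lemma generate_shifted_cellmap:
  assumes K: "subgroup K (homeo_plus UNIV)" and S: "S \<subseteq> carrier (homeo_group unit_int)"
    and unit: "\<And>\<nu>. \<nu> \<in> generate (homeo_group unit_int) S \<Longrightarrow> unit_homeo \<nu>"
    and gens: "\<And>\<nu>. \<nu> \<in> S \<Longrightarrow> shifted a (cellmap \<sigma> \<nu>) \<in> K"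
    and \<nu>: "\<nu> \<in> generate (homeo_group unit_int) S"
  shows "shifted a (cellmap \<sigma> \<nu>) \<in> K"
proof -
  let ?G = "homeo_group unit_int" and ?H = "homeo_plus UNIV"
  let ?\<phi> = "\<lambda>\<nu>. shifted a (cellmap \<sigma> \<nu>)"
  interpret U: group ?G by (rule group_homeo_group)
  interpret R: group ?H by (rule group_homeo_plus_UNIV)
  let ?G' = "?G\<lparr>carrier := generate ?G S\<rparr>"
  have sub: "subgroup (generate ?G S) ?G" using S by (rule U.generate_is_subgroup)
  have "?\<phi> \<in> hom ?G' ?H"
  proof (rule homI)
    fix \<mu> assume "\<mu> \<in> carrier ?G'"
    then have "unit_homeo \<mu>" using unit by simp
    then show "?\<phi> \<mu> \<in> carrier ?H"
      unfolding homeo_plus_UNIV_carrier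
      by (simp add: strict_mono_shifted strict_mono_cellmap surj_shifted surj_cellmap)
  next
    fix \<mu> \<mu>' assume "\<mu> \<in> carrier ?G'" "\<mu>' \<in> carrier ?G'"
    then have *: "unit_homeo \<mu>" "unit_homeo \<mu>'" using unit by simp_all
    \<comment> \<open>The product is truncated to the unit interval and
      \<open>\<mu>' \<circ> \<mu>\<close> is not, but \<open>cellmap\<close> evaluates only
      there.\<close>
    have "cellmap \<sigma> (compose unit_int \<mu>' \<mu>) = cellmap \<sigma> (\<mu>' \<circ> \<mu>)"
      by (rule cellmap_cong) (simp add: compose_def)
    then show "?\<phi> (\<mu> \<otimes>\<^bsub>?G'\<^esub> \<mu>') = ?\<phi> \<mu> \<otimes>\<^bsub>?H\<^esub> ?\<phi> \<mu>'"
      unfolding homeo_plus_UNIV_mult by (simp add: cellmap_comp[OF *] shifted_comp)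
  qed
  then interpret group_hom ?G' ?H ?\<phi>
    using U.subgroup_imp_group[OF sub]
    by (intro group_hom.intro group_hom_axioms.intro R.group_axioms)
  have S': "S \<subseteq> generate ?G S" by (auto intro: generate.incl)
  have "generate ?H (?\<phi> ` S) = ?\<phi> ` generate ?G' S"
    by (rule generate_img) (use S' in simp)
  also have "generate ?G' S = generate ?G S"
    by (rule U.generate_consistent[OF S' sub])
  finally have "?\<phi> \<nu> \<in> generate ?H (?\<phi> ` S)" using \<nu> by blast
  moreover have "generate ?H (?\<phi> ` S) \<subseteq> K"
    using gens by (intro R.generate_subgroup_incl[OF _ K]) auto
  ultimately show ?thesis by blast
qed

section \<open>An element of Thompson's group\<close>

lemma thompson_F_unit_homeo:
  assumes "f \<in> thompson_F"
  shows "unit_homeo f" "piecewise_linear f"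
  using assms by (auto simp: thompson_F_def unit_homeo_def homeomorphism_def)

text \<open>Any element of F supported in [1/16,15/16] that takes 1/4 beyond 3/4 would do; here 1/4
  goes to 13/16. The slopes are 1, 4, 1/4, 1/8, 1, with dyadic break points 1/16, 1/4, 9/16, 15/16;
  the form with \<open>max\<close> and \<open>min\<close> gives continuity at once.\<close>

definition push :: "real \<Rightarrow> real" where
  "push = (\<lambda>x\<in>unit_int. max x (min (4*x - 3/16) (min (x/4 + 3/4) (x/8 + 105/128))))"

lemma push_pieces:
  "0 \<le> x \<Longrightarrow> x \<le> 1/16 \<Longrightarrow> push x = x"
  "1/16 \<le> x \<Longrightarrow> x \<le> 1/4 \<Longrightarrow> push x = 4*x - 3/16"
  "1/4 \<le> x \<Longrightarrow> x \<le> 9/16 \<Longrightarrow> push x = x/4 + 3/4"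
  "9/16 \<le> x \<Longrightarrow> x \<le> 15/16 \<Longrightarrow> push x = x/8 + 105/128"
  "15/16 \<le> x \<Longrightarrow> x \<le> 1 \<Longrightarrow> push x = x"
  by (auto simp: push_def)

text \<open>Serves both piecewise linearity and the condition on derivatives, since the slope
  appears as a power of 2.\<close>

lemma push_affine:
  assumes "0 \<le> u" "u < v" "v \<le> 1" "{u<..<v} \<inter> {1/16, 1/4, 9/16, 15/16} = {}"
  shows "\<exists>(k::int) c. \<forall>x\<in>{u..v}. push x = 2 powi k * x + c"
proof -
  consider "v \<le> 1/16" | "1/16 \<le> u" "v \<le> 1/4" | "1/4 \<le> u" "v \<le> 9/16" | "9/16 \<le> u" "v \<le> 15/16" | "15/16 \<le> u"
  proof -
    have "\<not> (u < d \<and> d < v)" if "d \<in> {1/16, 1/4, 9/16, 15/16}" for d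
      using assms(4) that by auto
    from this[of "1/16"] this[of "1/4"] this[of "9/16"] this[of "15/16"] show ?thesis
      using that assms(2) by (auto simp: not_less)
  qed
  then show ?thesis
  proof cases
    case 1 then show ?thesis using assms by (intro exI[of _ 0] exI[of _ 0]) (auto simp: push_pieces)
  next
    case 2 then show ?thesis by (intro exI[of _ 2] exI[of _ "-3/16"]) (auto simp: push_pieces)
  next
    case 3 then show ?thesis by (intro exI[of _ "-2"] exI[of _ "3/4"]) (auto simp: push_pieces power_int_minus)
  next
    case 4 then show ?thesis by (intro exI[of _ "-3"] exI[of _ "105/128"]) (auto simp: push_pieces power_int_minus)
  next
    case 5 then show ?thesis using assms by (intro exI[of _ 0] exI[of _ 0]) (auto simp: push_pieces)
  qed
qed

lemma affine_on_derivative: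
  fixes f :: "real \<Rightarrow> real"
  assumes "\<And>y. y \<in> S \<Longrightarrow> f y = m * y + c" "x \<in> S"
  shows "(f has_real_derivative m) (at x within S)"
proof -
  have "((\<lambda>y. m * y + c) has_real_derivative m) (at x within S)"
    by (auto intro!: derivative_eq_intros)
  then show ?thesis
    by (rule has_field_derivative_transform_within[OF _ zero_less_one assms(2)]) (simp add: assms(1))
qed

lemma push_in_thompson_F_on: "push \<in> thompson_F_on (1/16) (15/16)"
proof -
  define D :: "real set" where "D = {1/16, 1/4, 9/16, 15/16}"
  have mono: "strict_mono_on unit_int push"
    by (intro strict_mono_onI) (auto simp: push_def min_def max_def)
  have cont: "continuous_on unit_int push"
  proof (rule continuous_on_eq)
    show "continuous_on unit_int (\<lambda>x. max x (min (4*x - 3/16) (min (x/4 + 3/4) (x/8 + 105/128))))"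
      by (intro continuous_intros) auto
  qed (simp add: push_def)
  have "push ` unit_int = unit_int"
  proof
    show "push ` unit_int \<subseteq> unit_int" by (auto simp: push_def min_def max_def)
    show "unit_int \<subseteq> push ` unit_int"
    proof
      fix y :: real assume "y \<in> unit_int"
      then obtain x where "0 \<le> x" "x \<le> 1" "push x = y"
        using IVT'[of push 0 y 1] cont by (auto simp: push_pieces)
      then show "y \<in> push ` unit_int" by auto
    qed
  qed
  then obtain g where "homeomorphism unit_int unit_int push g"
    using homeomorphism_compact[OF compact_Icc cont _ strict_mono_on_imp_inj_on[OF mono]] by blast
  moreover have "push \<in> extensional unit_int" by (simp add: push_def)
  ultimately have carrier: "push \<in> carrier (homeo_plus unit_int)" using mono by auto
  have aff: "\<exists>(k::int) c. \<forall>x\<in>{u..v}. push x = 2 powi k * x + c"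
    if "0 \<le> u" "u < v" "v \<le> 1" "{u<..<v} \<inter> D = {}" for u v
    using push_affine that unfolding D_def by blast
  have "piecewise_linear push"
    unfolding piecewise_linear_def
  proof (intro exI[of _ D] conjI allI impI)
    show "finite D" by (simp add: D_def)
    fix u v :: real
    assume "0 \<le> u \<and> u < v \<and> v \<le> 1 \<and> {u<..<v} \<inter> D = {}"
    then show "\<exists>m c. \<forall>x\<in>{u..v}. push x = m * x + c" using aff[of u v] by blast
  qed
  moreover have "push differentiable (at x within unit_int)" if x: "x \<in> unit_int - D" for x
  proof -
    have "open (- D)" by (intro open_Compl finite_imp_closed) (simp add: D_def)
    then obtain e where e: "e > 0" "ball x e \<subseteq> - D" using x by (auto simp: open_contains_ball)
    \<comment> \<open>Cutting the interval at 0 and 1 includes the end points of [0,1], where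
      derivatives are one-sided.\<close>
    define u v where "u = max 0 (x - e/2)" and "v = min 1 (x + e/2)"
    have uv: "0 \<le> u" "u < v" "v \<le> 1" "x \<in> {u..v}" using x e(1) by (auto simp: u_def v_def)
    have "{u<..<v} \<subseteq> ball x e" by (auto simp: u_def v_def dist_real_def)
    then obtain k :: int and c where kc: "\<forall>x\<in>{u..v}. push x = 2 powi k * x + c"
      using aff[OF uv(1-3)] e(2) by blast
    have "((\<lambda>y. 2 powi k * y + c) has_real_derivative 2 powi k) (at x within unit_int)"
      by (auto intro!: derivative_eq_intros)
    then have "(push has_real_derivative 2 powi k) (at x within unit_int)"
    proof (rule has_field_derivative_transform_within)
      fix y assume "y \<in> unit_int" "dist y x < e/2"
      then have "y \<in> unit_int" "x - e/2 < y \<and> y < x + e/2"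
        unfolding dist_real_def abs_diff_less_iff by blast+
      then have "y \<in> {u..v}" by (simp add: u_def v_def)
      then show "2 powi k * y + c = push y" using kc by simp
    qed (use e x in auto)
    then show ?thesis by (auto simp: real_differentiable_def)
  qed
  moreover have "finite D" by (simp add: D_def)
  moreover have "D \<subseteq> dyadic_rationals"
  proof -
    have "of_int m / 2 ^ n \<in> dyadic_rationals" for m n by (auto simp: dyadic_rationals_def)
    from this[of 1 4] this[of 1 2] this[of 9 4] this[of 15 4] show ?thesis by (simp add: D_def)
  qed
  moreover have "\<exists>k::int. d = 2 powi k"
    if x: "x \<in> unit_int" and d: "(push has_real_derivative d) (at x within unit_int)" for x d
  proof -
    \<comment> \<open>A closed piece containing \<open>x\<close> suffices even at a break point: a
      derivative within [0,1] restricts to the piece and equals its slope.\<close>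
    obtain u v where uv: "0 \<le> u" "u < v" "v \<le> 1" "{u<..<v} \<inter> D = {}" "x \<in> {u..v}"
    proof -
      consider "x \<in> {0..1/16}" | "x \<in> {1/16..1/4}" | "x \<in> {1/4..9/16}" | "x \<in> {9/16..15/16}" | "x \<in> {15/16..1}"
        using x by fastforce
      then show ?thesis
      proof cases
        case 1 then show ?thesis by (intro that[of 0 "1/16"]) (auto simp: D_def)
      next
        case 2 then show ?thesis by (intro that[of "1/16" "1/4"]) (auto simp: D_def)
      next
        case 3 then show ?thesis by (intro that[of "1/4" "9/16"]) (auto simp: D_def)
      next
        case 4 then show ?thesis by (intro that[of "9/16" "15/16"]) (auto simp: D_def)
      next
        case 5 then show ?thesis by (intro that[of "15/16" 1]) (auto simp: D_def)
      qed
    qed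
    obtain k :: int and c where kc: "\<forall>x\<in>{u..v}. push x = 2 powi k * x + c"
      using aff[OF uv(1-4)] by blast
    have "(push has_real_derivative 2 powi k) (at x within {u..v})"
      using kc uv(5) by (intro affine_on_derivative) auto
    moreover have "(push has_real_derivative d) (at x within {u..v})"
      using d by (rule DERIV_subset) (use uv in auto)
    moreover have "at x within {u..v} \<noteq> bot"
      using uv(2,5) by (simp add: trivial_limit_within)
    ultimately have "d = 2 powi k"
      unfolding has_field_derivative_iff using tendsto_unique by blast
    then show ?thesis by blast
  qed
  moreover have "supp push \<subseteq> {1/16..15/16}"
  proof
    fix x assume "x \<in> supp push"
    then show "x \<in> {1/16..15/16}"
      using push_pieces(1)[of x] push_pieces(5)[of x] by (fastforce simp: supp_def)
  qed
  ultimately show ?thesis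
    using carrier unfolding thompson_F_on_def thompson_F_def by blast
qed

section \<open>The theorem\<close>

lemma generators_in_F:
  assumes "generate (homeo_group unit_int) {\<nu>2, \<nu>3} = thompson_F_on (1/16) (15/16)"
    and "\<nu> \<in> generate (homeo_group unit_int) {\<nu>2, \<nu>3}"
  shows "unit_homeo \<nu>" "piecewise_linear \<nu>"
  using assms thompson_F_unit_homeo[of \<nu>] by (auto simp: thompson_F_on_def)

lemma nu1_eq:
  assumes "unit_homeo c" "t \<in> unit_int"
  shows "nu1 c t = 1 - c (1 - c t)"
proof -
  have "c ` unit_int \<subseteq> unit_int" "c t \<in> unit_int" using assms by (auto simp: unit_homeo_def)
  then show ?thesis using reflect_apply[of c "c t"] assms(2) by (simp add: nu1_def compose_def)
qed

lemma nu1_unit_homeo: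
  assumes "unit_homeo c"
  shows "unit_homeo (nu1 c)"
  using unit_homeo_comp[OF assms unit_homeo_flip[OF assms]]
  by (rule unit_homeo_cong) (simp add: nu1_eq[OF assms])

text \<open>Mirroring \<open>c\<close> negates the orientations, so the cellwise map of
  \<open>nu1 c\<close> is a product of two cellwise maps of \<open>c\<close>, and the composition
  lemma takes care of its break points.\<close>

lemma nu1_unif_piecewise_affine:
  assumes c: "unit_homeo c" "piecewise_linear c"
  shows "unif_piecewise_affine (cellmap \<sigma> (nu1 c))"
proof -
  have "cellmap \<sigma> (nu1 c) = cellmap \<sigma> ((\<lambda>t. 1 - c (1 - t)) \<circ> c)"
    by (rule cellmap_cong) (simp add: nu1_eq[OF c(1)])
  also have "\<dots> = cellmap (\<lambda>n. \<not> \<sigma> n) c \<circ> cellmap \<sigma> c"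
    by (simp only: cellmap_comp[OF c(1) unit_homeo_flip[OF c(1)]] cellmap_flip)
  finally show ?thesis
    using c by (simp add: unif_piecewise_affine_comp strict_mono_cellmap surj_cellmap
      bounded_displacement_cellmap unif_piecewise_affine_cellmap)
qed

theorem theorem1p3:
  fixes c0 \<nu>2 \<nu>3 :: "real \<Rightarrow> real" and \<rho> :: "real \<Rightarrow> letter"
  assumes c0_F: "c0 \<in> thompson_F"
    and c0_supp: "supp c0 = {0<..<1/4}"
    and c0_incr: "\<forall>x \<in> {0<..<1/4}. c0 x > x"
    and c0_germ: "\<forall>t \<in> {0<..<1/16}. c0 t = 2 * t"
    and nu2_homeo: "\<nu>2 \<in> carrier (homeo_group unit_int)"
    and nu2_supp: "supp \<nu>2 \<subseteq> {1/16<..<15/16}"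
    and nu3_homeo: "\<nu>3 \<in> carrier (homeo_group unit_int)"
    and nu3_supp: "supp \<nu>3 \<subseteq> {1/16<..<15/16}"
    and nu_gen: "generate (homeo_group unit_int) {\<nu>2, \<nu>3} = thompson_F_on (1/16) (15/16)"
    and rho_labelling: "labelling \<rho>"
    and rho_qp: "quasi_periodic \<rho>"
  shows "\<not> inner_amenable (G_rho (nu1 c0) \<nu>2 \<nu>3 \<rho>)"
proof -
  define gens where "gens = {zeta \<rho> (nu1 c0), zeta \<rho> \<nu>2, zeta \<rho> \<nu>3, chi \<rho> (nu1 c0), chi \<rho> \<nu>2, chi \<rho> \<nu>3}"
  define H where "H = generate (homeo_plus UNIV) gens"
  interpret R: group "homeo_plus UNIV" by (rule group_homeo_plus_UNIV)
  have in_gen: "\<nu>2 \<in> generate (homeo_group unit_int) {\<nu>2, \<nu>3}" "\<nu>3 \<in> generate (homeo_group unit_int) {\<nu>2, \<nu>3}"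
    by (auto intro: generate.incl)
  note \<nu>2 = generators_in_F[OF nu_gen in_gen(1)] and \<nu>3 = generators_in_F[OF nu_gen in_gen(2)]
  note c0 = thompson_F_unit_homeo[OF c0_F]
  have "gens \<subseteq> tame \<rho>"
    unfolding gens_def
    by (simp add: zeta_chi_tame[OF rho_labelling] nu1_unit_homeo nu1_unif_piecewise_affine
        unif_piecewise_affine_cellmap c0 \<nu>2 \<nu>3)
  then have H_tame: "H \<subseteq> tame \<rho>"
    unfolding H_def by (rule R.generate_subgroup_incl[OF _ subgroup_tame])
  have H: "subgroup H (homeo_plus UNIV)"
    unfolding H_def
    using \<open>gens \<subseteq> tame \<rho>\<close> subgroup.subset[OF subgroup_tame] by (intro R.generate_is_subgroup) blast
  have gens_H: "gens \<subseteq> H" unfolding H_def by (auto intro: generate.incl)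
  \<comment> \<open>Since \<open>\<nu>2\<close> and \<open>\<nu>3\<close> generate all of F on
    [1/16,15/16], \<open>push\<close> acts cellwise inside \<open>H\<close> through the
    \<open>zeta\<close> as well as the \<open>chi\<close> generators.\<close>
  have push: "push \<in> generate (homeo_group unit_int) {\<nu>2, \<nu>3}"
    using push_in_thompson_F_on nu_gen by simp
  have nus: "{\<nu>2, \<nu>3} \<subseteq> carrier (homeo_group unit_int)" using nu2_homeo nu3_homeo by simp
  define \<sigma> where "\<sigma> n = (\<rho> (of_int n + 1/2) = Let_b)" for n :: int
  define \<tau> where "\<tau> n = (\<rho> (of_int n) = Let_a)" for n :: int
  have zeta_push: "shifted 0 (cellmap \<sigma> push) \<in> H"
    by (rule generate_shifted_cellmap[OF H nus _ _ push])
      (use generators_in_F[OF nu_gen] gens_H \<nu>2(1) \<nu>3(1) in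
        \<open>auto simp: gens_def \<sigma>_def[abs_def] zeta_eq_cellmap[symmetric]\<close>)
  have chi_push: "shifted (1/2) (cellmap \<tau> push) \<in> H"
    by (rule generate_shifted_cellmap[OF H nus _ _ push])
      (use generators_in_F[OF nu_gen] gens_H \<nu>2(1) \<nu>3(1) in
        \<open>auto simp: gens_def \<tau>_def[abs_def] chi_eq_cellmap[symmetric]\<close>)
  have push': "unit_homeo push" "push (1/4) > 3/4" "t \<in> unit_int \<Longrightarrow> t \<le> push t" for t
    using generators_in_F[OF nu_gen push] by (auto simp: push_def)
  define A where "A a = {x. frac (x + a) \<in> {1/4..3/4}}" for a :: real
  obtain P where P: "shifted 0 (cellmap \<sigma> push) ` (A 0 \<union> P) \<subseteq> P" "A 0 \<inter> P = {}"
    using shifted_cellmap_wandering[OF push', of 0 \<sigma>] unfolding A_def by metis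
  obtain Q where Q: "shifted (1/2) (cellmap \<tau> push) ` (A (1/2) \<union> Q) \<subseteq> Q" "A (1/2) \<inter> Q = {}"
    using shifted_cellmap_wandering[OF push', of "1/2" \<tau>] unfolding A_def by metis
  \<comment> \<open>The two families of closed middle halves meet only at the odd multiples of 1/4,
    so they cover the line without slack.\<close>
  have "x \<in> A 0 \<union> A (1/2)" for x
  proof -
    have "frac (x + 1/2) = (if frac x < 1/2 then frac x + 1/2 else frac x - 1/2)"
      using frac_add[of x "1/2"] by (simp add: frac_eq)
    then show ?thesis using frac_lt_1[of x] by (auto simp: A_def)
  qed
  then have cover: "A 0 \<union> A (1/2) = UNIV" by blast
  have cont: "continuous_on UNIV g" if "g \<in> H" for g
    using that H_tame by (intro continuous_strict_mono_surj) (auto simp: tame_def)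
  have "\<not> inner_amenable ((homeo_plus UNIV)\<lparr>carrier := H\<rparr>)"
  proof (rule not_inner_amenable_criterion[OF H _ _ _ zeta_push P chi_push Q cover])
    fix g assume g: "g \<in> H"
    then have tame: "g \<in> tame \<rho>" using H_tame by blast
    then show "bounded_displacement g" by (simp add: tame_def)
    show "\<exists>x. g x = x"
      using reflection_equivariant_fixed_point[OF rho_qp _ cont[OF g]] tame by (simp add: tame_def)
    show "unif_loc_finite (fix_frontier g)"
      using unif_loc_finite_fix_frontier[OF _ cont[OF g]] tame by (simp add: tame_def)
  qed
  then show ?thesis by (simp add: G_rho_def H_def gens_def)
qed

end
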